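(* Let $(P,\Lambda)$ be a Poisson manifold, with tangent bundle $\tau_P:TP\to P$. There exists on the manifold $TP$ a Poisson structure, determined by that of $P$ (and called its tangent lift), such that for any two smooth functions $f,g\in C^\infty(P,\mathbb R)$, $$\{df,dg\}_{TP}=d\{f,g\}_P,\qquad \{f\circ\tau_P,g\circ\tau_P\}_{TP}=0,\qquad \{df,g\circ\tau_P\}_{TP}=\{f,g\}_P\circ\tau_P.$$ Here $\{\ ,\ \}_P$ and $\{\ ,\ \}_{TP}$ denote the Poisson brackets of functions on $P$ and $TP$ respectively, and $df$, $dg$, $d\{f,g\}_P$ are considered as functions on $TP$, linear on the fibres.
   Context: A Poisson structure on a manifold $N$ is a Lie algebra bracket on $C^\infty(N,\mathbb R)$ satisfying $\{f,gh\}=\{f,g\}h+g\{f,h\}$; equivalently it is given by a smooth bivector field $\Lambda$ with vanishing Schouten-Nijenhuis square, with $\{f,g\}=\Lambda(df,dg)$. A $1$-form $\eta$ on $P$ is regarded as the function $v\mapsto\langle\eta(\tau_P(v)),v\rangle$ on $TP$. *)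

theory Defs
  imports "HOL-Analysis.Analysis" "HOL-Library.Function_Algebras"
begin

section \<open>Smooth maps between open subsets of Euclidean spaces\<close>

primrec Ck_on ::
    "nat \<Rightarrow> ('e::euclidean_space \<Rightarrow> 'f::real_normed_vector) \<Rightarrow> 'e set \<Rightarrow> bool" where
  "Ck_on 0 f S \<longleftrightarrow> continuous_on S f"
| "Ck_on (Suc k) f S \<longleftrightarrow>
     (\<forall>x\<in>S. f differentiable (at x)) \<and>
     (\<forall>v. Ck_on k (\<lambda>x. frechet_derivative f (at x) v) S)"

definition smooth_on ::
    "('e::euclidean_space \<Rightarrow> 'f::real_normed_vector) \<Rightarrow> 'e set \<Rightarrow> bool" where
  "smooth_on f S \<longleftrightarrow> (\<forall>k. Ck_on k f S)"


section \<open>Smooth manifolds\<close>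

text \<open>
  A chart is a domain together with a coordinate map; the values of the map outside the domain
  are irrelevant.  A manifold is given by an atlas, which need not be maximal: its points are
  those covered by the charts, and its topology is the one making every chart a homeomorphism
  onto its image.
\<close>

type_synonym ('a, 'e) chart = "'a set \<times> ('a \<Rightarrow> 'e)"

definition points :: "('a, 'e) chart set \<Rightarrow> 'a set" where
  "points A = \<Union> (fst ` A)"

definition atlas_topology :: "('a, 'e::euclidean_space) chart set \<Rightarrow> 'a topology" where
  "atlas_topology A =
     topology_generated_by {{x \<in> U. \<phi> x \<in> S} | U \<phi> S. (U, \<phi>) \<in> A \<and> open S}"

locale smooth_manifold =
  fixes A :: "('a, 'e::euclidean_space) chart set"
  assumes chart_inj: "(U, \<phi>) \<in> A \<Longrightarrow> inj_on \<phi> U"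
    and chart_open: "(U, \<phi>) \<in> A \<Longrightarrow> (V, \<psi>) \<in> A \<Longrightarrow> open (\<phi> ` (U \<inter> V))"
    and transition_smooth:
      "(U, \<phi>) \<in> A \<Longrightarrow> (V, \<psi>) \<in> A \<Longrightarrow> smooth_on (\<psi> \<circ> inv_into U \<phi>) (\<phi> ` (U \<inter> V))"
    and Hausdorff: "Hausdorff_space (atlas_topology A)"
    and second_countable: "second_countable (atlas_topology A)"

definition zero_ext :: "'a set \<Rightarrow> ('a \<Rightarrow> real) \<Rightarrow> 'a \<Rightarrow> real" where
  "zero_ext S f = (\<lambda>x. if x \<in> S then f x else 0)"

text \<open>
  The algebra of smooth real functions on a manifold.  Functions are total in HOL, so each
  smooth function is represented by its extension by zero; in particular the unit of the
  algebra is \<open>zero_ext (points A) 1\<close>.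
\<close>

definition smooth_functions :: "('a, 'e::euclidean_space) chart set \<Rightarrow> ('a \<Rightarrow> real) set" where
  "smooth_functions A =
     {f. (\<forall>x. x \<notin> points A \<longrightarrow> f x = 0) \<and>
         (\<forall>(U, \<phi>) \<in> A. smooth_on (f \<circ> inv_into U \<phi>) (\<phi> ` U))}"


section \<open>The tangent bundle\<close>

text \<open>
  Tangent vectors at \<open>p\<close> are the derivations at \<open>p\<close> of the algebra of smooth functions.
\<close>

type_synonym 'a tangent_vector = "('a \<Rightarrow> real) \<Rightarrow> real"

definition tangent_space ::
    "('a, 'e::euclidean_space) chart set \<Rightarrow> 'a \<Rightarrow> 'a tangent_vector set" where
  "tangent_space A p =
     {v. (\<forall>f \<in> smooth_functions A. \<forall>g \<in> smooth_functions A. v (f + g) = v f + v g) \<and>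
         (\<forall>c. \<forall>f \<in> smooth_functions A. v (\<lambda>x. c * f x) = c * v f) \<and>
         (\<forall>f \<in> smooth_functions A. \<forall>g \<in> smooth_functions A.
            v (f * g) = v f * g p + f p * v g) \<and>
         (\<forall>f. f \<notin> smooth_functions A \<longrightarrow> v f = 0)}"

definition tangent_bundle ::
    "('a, 'e::euclidean_space) chart set \<Rightarrow> ('a \<times> 'a tangent_vector) set" where
  "tangent_bundle A = Sigma (points A) (tangent_space A)"

text \<open>
  The components, in a chart, of a tangent vector \<open>v\<close> at \<open>p\<close>: the vector \<open>w\<close> such that \<open>v\<close> is
  differentiation in direction \<open>w\<close> in the coordinates of the chart.  On a smooth manifold it
  exists and is unique when \<open>p\<close> lies in the chart domain.
\<close>

definition tangent_components ::
    "('a, 'e::euclidean_space) chart set \<Rightarrow> ('a, 'e) chart \<Rightarrow> 'a \<Rightarrow> 'a tangent_vector \<Rightarrow> 'e" where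
  "tangent_components A c p v =
     (THE w. \<forall>f \<in> smooth_functions A.
        v f = frechet_derivative (f \<circ> inv_into (fst c) (snd c)) (at (snd c p)) w)"

definition tangent_chart ::
    "('a, 'e::euclidean_space) chart set \<Rightarrow> ('a, 'e) chart \<Rightarrow>
     ('a \<times> 'a tangent_vector, 'e \<times> 'e) chart" where
  "tangent_chart A c =
     ({z \<in> tangent_bundle A. fst z \<in> fst c},
      \<lambda>z. (snd c (fst z), tangent_components A c (fst z) (snd z)))"

text \<open>The manifold structure of the tangent bundle.\<close>

definition tangent_atlas ::
    "('a, 'e::euclidean_space) chart set \<Rightarrow> ('a \<times> 'a tangent_vector, 'e \<times> 'e) chart set" where
  "tangent_atlas A = tangent_chart A ` A"

text \<open>The function \<open>f \<circ> \<tau>\<close> on the tangent bundle, where \<open>\<tau> = fst\<close> is the projection.\<close>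

definition tangent_pullback ::
    "('a, 'e::euclidean_space) chart set \<Rightarrow> ('a \<Rightarrow> real) \<Rightarrow> 'a \<times> 'a tangent_vector \<Rightarrow> real" where
  "tangent_pullback A f = zero_ext (tangent_bundle A) (f \<circ> fst)"

text \<open>A 1-form assigns to each point a functional on the tangent space at that point.\<close>

definition differential :: "('a \<Rightarrow> real) \<Rightarrow> 'a \<Rightarrow> 'a tangent_vector \<Rightarrow> real" where
  "differential f p v = v f"

definition form_function ::
    "('a, 'e::euclidean_space) chart set \<Rightarrow> ('a \<Rightarrow> 'a tangent_vector \<Rightarrow> real) \<Rightarrow>
     'a \<times> 'a tangent_vector \<Rightarrow> real" where
  "form_function A \<eta> = zero_ext (tangent_bundle A) (\<lambda>(p, v). \<eta> p v)"


section \<open>Poisson manifolds\<close>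

text \<open>
  A Poisson structure is a bracket on the smooth functions.  By convention the bracket is zero
  when an argument is not a smooth function, so that equality of Poisson structures is equality
  of their values on smooth functions.
\<close>

locale poisson_manifold = smooth_manifold A
  for A :: "('a, 'e::euclidean_space) chart set" +
  fixes bracket :: "('a \<Rightarrow> real) \<Rightarrow> ('a \<Rightarrow> real) \<Rightarrow> 'a \<Rightarrow> real"
  assumes bracket_smooth:
      "f \<in> smooth_functions A \<Longrightarrow> g \<in> smooth_functions A \<Longrightarrow> bracket f g \<in> smooth_functions A"
    and bracket_undefined:
      "f \<notin> smooth_functions A \<or> g \<notin> smooth_functions A \<Longrightarrow> bracket f g = 0"
    and bracket_add:
      "f \<in> smooth_functions A \<Longrightarrow> g \<in> smooth_functions A \<Longrightarrow> h \<in> smooth_functions A \<Longrightarrow>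
       bracket (f + g) h = bracket f h + bracket g h"
    and bracket_scale:
      "f \<in> smooth_functions A \<Longrightarrow> g \<in> smooth_functions A \<Longrightarrow>
       bracket (\<lambda>x. c * f x) g = (\<lambda>x. c * bracket f g x)"
    and bracket_antisym:
      "f \<in> smooth_functions A \<Longrightarrow> g \<in> smooth_functions A \<Longrightarrow> bracket f g = - bracket g f"
    and bracket_Jacobi:
      "f \<in> smooth_functions A \<Longrightarrow> g \<in> smooth_functions A \<Longrightarrow> h \<in> smooth_functions A \<Longrightarrow>
       bracket f (bracket g h) + bracket g (bracket h f) + bracket h (bracket f g) = 0"
    and bracket_Leibniz:
      "f \<in> smooth_functions A \<Longrightarrow> g \<in> smooth_functions A \<Longrightarrow> h \<in> smooth_functions A \<Longrightarrow>
       bracket f (g * h) = bracket f g * h + g * bracket f h"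

end

theory Submission
  imports Defs
begin

text \<open>
  Tangent vectors of \<open>TP\<close> are separated by the functions \<open>df\<close> and \<open>f \<circ> \<tau>\<close>: in the chart
  \<open>(x, w)\<close> induced by a chart of \<open>P\<close>, a vector killing all \<open>f \<circ> \<tau>\<close> is vertical, and on vertical
  vectors the \<open>df\<close> act like the differentials of functions on \<open>P\<close>.  Every slot of a
  biderivation, evaluated at a point, is a tangent vector, so a biderivation is determined by its
  values on these generators; this gives uniqueness, antisymmetry and independence of charts.
  Existence is local: if \<open>\<Lambda>\<^sup>i\<^sup>j\<close> are the components of the Poisson bivector, the lift is
  \<open>\<Sum> \<Lambda>\<^sup>i\<^sup>j (\<partial>F/\<partial>w\<^sup>i \<partial>G/\<partial>x\<^sup>j + \<partial>F/\<partial>x\<^sup>i \<partial>G/\<partial>w\<^sup>j) + d\<Lambda>\<^sup>i\<^sup>j(w) \<partial>F/\<partial>w\<^sup>i \<partial>G/\<partial>w\<^sup>j\<close>.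
  The Jacobiator is a derivation in each argument, so the Jacobi identity also needs checking on
  generators only, where it reduces to the one on \<open>P\<close>.
\<close>
section \<open>Calculus of smooth maps\<close>

text \<open>The formula of the lift is forced by its values on \<open>df\<close> and
  \<open>dg\<close>. In a chart \<open>df\<close> is the function (x, w) to Df(x) w, whose fibre
  derivative in direction i is the partial derivative of f and whose base derivative in direction i
  is, by symmetry of second derivatives, the derivative of that partial derivative along w.
  Differentiating {f, g}, the sum of \<Lambda>(i, j) times the partials of f and g, along w by the
  product rule expresses d{f, g} through exactly these quantities, and the three kinds of summands
  are the three terms of the lift.

  The obstacle is that tangent vectors are derivations of the algebra of global smooth functions,
  while coordinates exist only locally. Every passage between a derivation and its components
  therefore needs cutoffs, which are smooth only because the manifold is Hausdorff, together with
  Hadamard's lemma. The same passage is used for vectors tangent to TP, so TP has to be shown to be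
  a Hausdorff manifold before anything can be said about brackets on it.\<close>

lemma Ck_on_cong:
  assumes "open S" "\<And>x. x \<in> S \<Longrightarrow> f x = g x" "Ck_on k f S"
  shows "Ck_on k g S"
  using assms(2,3)
proof (induction k arbitrary: f g)
  case 0
  then show ?case using continuous_on_cong by (metis Ck_on.simps(1))
next
  case (Suc k)
  have der: "(g has_derivative frechet_derivative f (at x)) (at x)" if "x \<in> S" for x
    using has_derivative_transform_within_open[OF _ \<open>open S\<close> that Suc.prems(1)]
      Suc.prems(2) that by (simp add: frechet_derivative_works)
  then have eq: "frechet_derivative f (at x) = frechet_derivative g (at x)" if "x \<in> S" for x
    using frechet_derivative_at that by blast
  show ?case
    unfolding Ck_on.simps
  proof (intro conjI ballI allI)
    show "g differentiable (at x)" if "x \<in> S" for x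
      using der that differentiableI by blast
    show "Ck_on k (\<lambda>x. frechet_derivative g (at x) v) S" for v
      using Suc.IH[of "\<lambda>x. frechet_derivative f (at x) v"] eq Suc.prems(2) by simp
  qed
qed

text \<open>\<open>frechet_derivative\<close> is a choice operator; by uniqueness of derivatives an
  explicit derivative may stand in for it, which keeps the later inductions free of the
  choice.\<close>

lemma Ck_on_SucI:
  assumes "open S" "\<And>x. x \<in> S \<Longrightarrow> (f has_derivative f' x) (at x)"
    and "\<And>v. Ck_on k (\<lambda>x. f' x v) S"
  shows "Ck_on (Suc k) f S"
  unfolding Ck_on.simps
proof (intro conjI ballI allI)
  show "f differentiable (at x)" if "x \<in> S" for x
    using assms(2) that differentiableI by blast
  have "f' x = frechet_derivative f (at x)" if "x \<in> S" for x
    using assms(2) that frechet_derivative_at by blast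
  then show "Ck_on k (\<lambda>x. frechet_derivative f (at x) v) S" for v
    using Ck_on_cong[OF assms(1) _ assms(3)[of v]] by simp
qed

lemma Ck_on_has_derivative:
  assumes "Ck_on (Suc k) f S" "x \<in> S"
  shows "(f has_derivative frechet_derivative f (at x)) (at x)"
  using assms by (simp add: frechet_derivative_works)

lemma Ck_on_subset: "Ck_on k f S \<Longrightarrow> T \<subseteq> S \<Longrightarrow> Ck_on k f T"
  by (induction k arbitrary: f) (auto intro: continuous_on_subset)

text \<open>Both continuity and differentiability at a point see only a neighbourhood of it, so the
  recursion never leaves the local picture.\<close>

lemma Ck_on_local:
  assumes "\<And>x. x \<in> S \<Longrightarrow> \<exists>N. open N \<and> x \<in> N \<and> Ck_on k f N"
  shows "Ck_on k f S"
  using assms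
proof (induction k arbitrary: f)
  case 0
  show ?case
    unfolding Ck_on.simps
  proof (intro continuous_at_imp_continuous_on ballI)
    fix x assume "x \<in> S"
    then obtain N where "open N" "x \<in> N" "continuous_on N f"
      using 0 by auto
    then show "isCont f x" using continuous_on_eq_continuous_at by blast
  qed
next
  case (Suc k)
  show ?case
    unfolding Ck_on.simps
  proof (intro conjI ballI allI)
    show "f differentiable (at x)" if "x \<in> S" for x
      using Suc.prems[OF that] by auto
    show "Ck_on k (\<lambda>x. frechet_derivative f (at x) v) S" for v
      using Suc.prems by (intro Suc.IH) fastforce
  qed
qed

lemma Ck_on_SucD: "Ck_on (Suc k) f S \<Longrightarrow> Ck_on k f S"
proof (induction k arbitrary: f)
  case 0
  then show ?case
    by (auto intro!: continuous_at_imp_continuous_on differentiable_imp_continuous_within)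
next
  case (Suc k)
  then show ?case by (subst Ck_on.simps(2)) (auto simp del: Ck_on.simps simp: Ck_on.simps(2)[of "Suc k"])
qed

lemma Ck_on_const: "open S \<Longrightarrow> Ck_on k (\<lambda>x. c) S"
proof (induction k arbitrary: c)
  case (Suc k)
  then show ?case by (intro Ck_on_SucI[where f' = "\<lambda>x v. 0"]) (auto intro: derivative_eq_intros)
qed auto

lemma Ck_on_bounded_linear_compose:
  assumes "bounded_linear L" "open S" "Ck_on k f S"
  shows "Ck_on k (\<lambda>x. L (f x)) S"
  using assms(3)
proof (induction k arbitrary: f)
  case 0
  then show ?case by (auto intro: bounded_linear.continuous_on[OF assms(1)])
next
  case (Suc k)
  show ?case
  proof (rule Ck_on_SucI[OF assms(2)])
    show "((\<lambda>x. L (f x)) has_derivative (\<lambda>v. L (frechet_derivative f (at x) v))) (at x)" if "x \<in> S" for x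
      by (intro bounded_linear.has_derivative[OF assms(1)] Ck_on_has_derivative[OF Suc.prems that])
    show "Ck_on k (\<lambda>x. L (frechet_derivative f (at x) v)) S" for v
      using Suc.prems by (intro Suc.IH) auto
  qed
qed

lemma Ck_on_id: "open S \<Longrightarrow> Ck_on k (\<lambda>x. x) S"
proof (cases k)
  case (Suc j)
  assume "open S"
  then show ?thesis
    unfolding Suc by (intro Ck_on_SucI[where f' = "\<lambda>x v. v"]) (auto intro: Ck_on_const derivative_eq_intros)
qed simp

lemma Ck_on_add:
  assumes "open S" "Ck_on k f S" "Ck_on k g S"
  shows "Ck_on k (\<lambda>x. f x + g x) S"
  using assms(2,3)
proof (induction k arbitrary: f g)
  case 0
  then show ?case by (auto intro: continuous_on_add)
next
  case (Suc k)
  show ?case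
  proof (rule Ck_on_SucI[OF assms(1)])
    show "((\<lambda>x. f x + g x) has_derivative
        (\<lambda>v. frechet_derivative f (at x) v + frechet_derivative g (at x) v)) (at x)" if "x \<in> S" for x
      by (intro has_derivative_add Ck_on_has_derivative[OF Suc.prems(1) that]
          Ck_on_has_derivative[OF Suc.prems(2) that])
    show "Ck_on k (\<lambda>x. frechet_derivative f (at x) v + frechet_derivative g (at x) v) S" for v
      using Suc.prems by (intro Suc.IH) auto
  qed
qed

lemma Ck_on_bilinear:
  assumes "bounded_bilinear B" "open S" "Ck_on k f S" "Ck_on k g S"
  shows "Ck_on k (\<lambda>x. B (f x) (g x)) S"
  using assms(3,4)
proof (induction k arbitrary: f g)
  case 0
  then show ?case by (auto intro: bounded_bilinear.continuous_on[OF assms(1)])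
next
  case (Suc k)
  show ?case
  proof (rule Ck_on_SucI[OF assms(2)])
    show "((\<lambda>x. B (f x) (g x)) has_derivative
        (\<lambda>v. B (f x) (frechet_derivative g (at x) v) + B (frechet_derivative f (at x) v) (g x))) (at x)"
      if "x \<in> S" for x
      by (intro bounded_bilinear.FDERIV[OF assms(1)] Ck_on_has_derivative[OF Suc.prems(1) that]
          Ck_on_has_derivative[OF Suc.prems(2) that])
    show "Ck_on k (\<lambda>x. B (f x) (frechet_derivative g (at x) v) + B (frechet_derivative f (at x) v) (g x)) S" for v
      \<comment> \<open>In each summand of the product rule one factor stays undifferentiated, of
        order \<open>Suc k\<close>; it is lowered to order \<open>k\<close> to meet the induction
        hypothesis.\<close>
      using Suc.prems Ck_on_SucD[of k f S] Ck_on_SucD[of k g S]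
      by (intro Ck_on_add[OF assms(2)] Suc.IH) auto
  qed
qed

lemma smooth_on_cong:
  assumes "open S" "\<And>x. x \<in> S \<Longrightarrow> f x = g x" "smooth_on f S"
  shows "smooth_on g S"
  using assms Ck_on_cong unfolding smooth_on_def by blast

lemma smooth_on_subset: "smooth_on f S \<Longrightarrow> T \<subseteq> S \<Longrightarrow> smooth_on f T"
  unfolding smooth_on_def using Ck_on_subset by blast

lemma smooth_on_local:
  assumes "\<And>x. x \<in> S \<Longrightarrow> \<exists>N. open N \<and> x \<in> N \<and> smooth_on f N"
  shows "smooth_on f S"
  using assms unfolding smooth_on_def by (metis Ck_on_local)

lemma smooth_on_has_derivative:
  "smooth_on f S \<Longrightarrow> x \<in> S \<Longrightarrow> (f has_derivative frechet_derivative f (at x)) (at x)"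
  unfolding smooth_on_def using Ck_on_has_derivative by blast

lemma smooth_on_imp_continuous_on: "smooth_on f S \<Longrightarrow> continuous_on S f"
  unfolding smooth_on_def using Ck_on.simps(1) by blast

lemma smooth_on_derivative: "smooth_on f S \<Longrightarrow> smooth_on (\<lambda>x. frechet_derivative f (at x) v) S"
  unfolding smooth_on_def using Ck_on.simps(2) by blast

lemma smooth_on_const: "open S \<Longrightarrow> smooth_on (\<lambda>x. c) S"
  unfolding smooth_on_def by (simp add: Ck_on_const)

lemma smooth_on_id: "open S \<Longrightarrow> smooth_on (\<lambda>x. x) S"
  unfolding smooth_on_def by (simp add: Ck_on_id)

lemma smooth_on_bounded_linear_compose:
  "bounded_linear L \<Longrightarrow> open S \<Longrightarrow> smooth_on f S \<Longrightarrow> smooth_on (\<lambda>x. L (f x)) S"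
  unfolding smooth_on_def by (simp add: Ck_on_bounded_linear_compose)

lemma smooth_on_bounded_linear: "bounded_linear L \<Longrightarrow> open S \<Longrightarrow> smooth_on L S"
  using smooth_on_bounded_linear_compose smooth_on_id by fastforce

lemma smooth_on_add:
  "open S \<Longrightarrow> smooth_on f S \<Longrightarrow> smooth_on g S \<Longrightarrow> smooth_on (\<lambda>x. f x + g x) S"
  unfolding smooth_on_def by (simp add: Ck_on_add)

lemma smooth_on_bilinear:
  "bounded_bilinear B \<Longrightarrow> open S \<Longrightarrow> smooth_on f S \<Longrightarrow> smooth_on g S \<Longrightarrow>
    smooth_on (\<lambda>x. B (f x) (g x)) S"
  unfolding smooth_on_def by (simp add: Ck_on_bilinear)

lemmas smooth_on_mult = smooth_on_bilinear[OF bounded_bilinear_mult]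
lemmas smooth_on_scaleR = smooth_on_bilinear[OF bounded_bilinear_scaleR]

lemma smooth_on_minus:
  "open S \<Longrightarrow> smooth_on f S \<Longrightarrow> smooth_on (\<lambda>x. - f x) S"
  by (rule smooth_on_bounded_linear_compose) (auto intro: bounded_linear_minus bounded_linear_ident)

lemma smooth_on_diff:
  "open S \<Longrightarrow> smooth_on f S \<Longrightarrow> smooth_on g S \<Longrightarrow> smooth_on (\<lambda>x. f x - g x) S"
  using smooth_on_add[of S f "\<lambda>x. - g x"] smooth_on_minus[of S g] by simp

lemma smooth_on_sum:
  "open S \<Longrightarrow> (\<And>i. i \<in> I \<Longrightarrow> smooth_on (f i) S) \<Longrightarrow> smooth_on (\<lambda>x. \<Sum>i\<in>I. f i x) S"
  by (induction I rule: infinite_finite_induct) (auto intro: smooth_on_const smooth_on_add)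

lemma smooth_on_Pair:
  assumes "open S" "smooth_on f S" "smooth_on g S"
  shows "smooth_on (\<lambda>x. (f x, g x)) S"
proof -
  have "smooth_on (\<lambda>x. (f x, 0) + (0, g x)) S"
    using assms
    by (intro smooth_on_add smooth_on_bounded_linear_compose[of "\<lambda>u. (u, 0)"] smooth_on_bounded_linear_compose[of "\<lambda>u. (0, u)"])
      (auto intro!: bounded_linear_Pair bounded_linear_ident bounded_linear_zero)
  then show ?thesis by simp
qed

lemma Ck_on_sum:
  "open S \<Longrightarrow> (\<And>i. i \<in> I \<Longrightarrow> Ck_on k (f i) S) \<Longrightarrow> Ck_on k (\<lambda>x. \<Sum>i\<in>I. f i x) S"
  by (induction I rule: infinite_finite_induct) (auto intro: Ck_on_const Ck_on_add)

text \<open>\<open>Ck_on\<close> differentiates in a fixed direction. This trades a direction that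
  varies with the point for the fixed basis directions with scalar weights.\<close>

lemma derivative_basis_expansion:
  assumes "bounded_linear L"
  shows "L v = (\<Sum>i\<in>Basis. (v \<bullet> i) *\<^sub>R L i)"
proof -
  interpret bounded_linear L by fact
  have "L v = L (\<Sum>i\<in>Basis. (v \<bullet> i) *\<^sub>R i)" by (simp add: euclidean_representation)
  then show ?thesis by (simp add: sum scaleR)
qed

text \<open>Since \<open>f\<close> is smooth it never loses an order, so induction on the order of
  \<open>g\<close> alone suffices. The chain rule differentiates \<open>g\<close> in a moving
  direction; the basis expansion turns this into fixed-direction derivatives, to which the induction
  hypothesis applies.\<close>

lemma Ck_on_compose:
  assumes "open S" "open T" "smooth_on f S" "f ` S \<subseteq> T" "Ck_on k g T"
  shows "Ck_on k (\<lambda>x. g (f x)) S"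
  using assms(5)
proof (induction k arbitrary: g)
  case 0
  then show ?case
    using assms smooth_on_imp_continuous_on[OF assms(3)] by (auto intro: continuous_on_compose2)
next
  case (Suc k)
  let ?f = "\<lambda>x. frechet_derivative f (at x)"
  let ?g = "\<lambda>x. frechet_derivative g (at x)"
  show ?case
  proof (rule Ck_on_SucI[OF assms(1), where f' = "\<lambda>x v. \<Sum>i\<in>Basis. (?f x v \<bullet> i) *\<^sub>R ?g (f x) i"])
    fix x assume x: "x \<in> S"
    have g: "(g has_derivative ?g (f x)) (at (f x))"
      using assms(4) x Ck_on_has_derivative[OF Suc.prems] by blast
    have "((\<lambda>x. g (f x)) has_derivative (\<lambda>v. ?g (f x) (?f x v))) (at x)"
      by (rule has_derivative_compose[OF smooth_on_has_derivative[OF assms(3) x] g])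
    moreover have "?g (f x) (?f x v) = (\<Sum>i\<in>Basis. (?f x v \<bullet> i) *\<^sub>R ?g (f x) i)" for v
      using derivative_basis_expansion[OF has_derivative_bounded_linear[OF g]] .
    ultimately show "((\<lambda>x. g (f x)) has_derivative
        (\<lambda>v. \<Sum>i\<in>Basis. (?f x v \<bullet> i) *\<^sub>R ?g (f x) i)) (at x)" by simp
  next
    fix v
    have "Ck_on k (\<lambda>x. (?f x v \<bullet> i) *\<^sub>R ?g (f x) i) S" for i
    proof (rule Ck_on_bilinear[OF bounded_bilinear_scaleR assms(1)])
      show "Ck_on k (\<lambda>x. ?f x v \<bullet> i) S"
        using smooth_on_derivative[OF assms(3), of v] unfolding smooth_on_def
        by (intro Ck_on_bounded_linear_compose[OF bounded_linear_inner_left assms(1)]) auto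
      show "Ck_on k (\<lambda>x. ?g (f x) i) S"
        using Suc.IH[of "\<lambda>x. ?g x i"] Suc.prems by auto
    qed
    then show "Ck_on k (\<lambda>x. \<Sum>i\<in>Basis. (?f x v \<bullet> i) *\<^sub>R ?g (f x) i) S"
      by (intro Ck_on_sum assms(1))
  qed
qed

lemma smooth_on_compose:
  "open S \<Longrightarrow> open T \<Longrightarrow> smooth_on f S \<Longrightarrow> f ` S \<subseteq> T \<Longrightarrow> smooth_on g T \<Longrightarrow>
    smooth_on (\<lambda>x. g (f x)) S"
  using Ck_on_compose unfolding smooth_on_def[of _ T] smooth_on_def[of "\<lambda>x. g (f x)"] by blast

text \<open>Linearity in the vector reduces joint smoothness in base point and vector to the partial
  derivatives. This serves the transition maps of the tangent atlas, the functions
  \<open>df\<close>, and the term of the lift that contains the derivative of \<Lambda>.\<close>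

lemma smooth_on_differential:
  assumes "open S" "smooth_on f S"
  shows "smooth_on (\<lambda>z. frechet_derivative f (at (fst z)) (snd z)) (S \<times> UNIV)"
proof (rule smooth_on_cong)
  show o: "open (S \<times> (UNIV :: 'a set))" using assms(1) by (simp add: open_Times)
  have "smooth_on (\<lambda>z. frechet_derivative f (at (fst z)) i) (S \<times> (UNIV :: 'a set))" for i
    by (rule smooth_on_compose[OF o assms(1) _ _ smooth_on_derivative[OF assms(2)]])
      (auto intro: smooth_on_bounded_linear bounded_linear_fst o)
  moreover have "smooth_on (\<lambda>z. snd z \<bullet> i) (S \<times> (UNIV :: 'a set))" for i
    by (intro smooth_on_bounded_linear o bounded_linear_inner_left_comp bounded_linear_snd)
  ultimately show "smooth_on (\<lambda>z. \<Sum>i\<in>Basis. (snd z \<bullet> i) *\<^sub>R frechet_derivative f (at (fst z)) i) (S \<times> UNIV)"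
    by (intro smooth_on_sum smooth_on_scaleR o)
  show "(\<Sum>i\<in>Basis. (snd z \<bullet> i) *\<^sub>R frechet_derivative f (at (fst z)) i) =
      frechet_derivative f (at (fst z)) (snd z)" if "z \<in> S \<times> UNIV" for z
    using that derivative_basis_expansion[OF has_derivative_bounded_linear[OF smooth_on_has_derivative[OF assms(2)]]]
    by (metis mem_Times_iff)
qed

text \<open>The derivative of \<open>inverse\<close> is a polynomial in \<open>inverse\<close>
  itself, so the induction closes.\<close>

lemma Ck_on_inverse: "Ck_on k inverse (- {0 :: real})"
proof (induction k)
  case 0
  show ?case by (auto intro: continuous_intros)
next
  case (Suc k)
  show ?case
  proof (rule Ck_on_SucI[where f' = "\<lambda>x v. - (inverse x * v * inverse x)"])
    have "Ck_on k (\<lambda>x. inverse x * inverse x) (- {0 :: real})"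
      using Ck_on_bilinear[OF bounded_bilinear_mult _ Suc Suc] by auto
    then have "Ck_on k (\<lambda>x. (- v) * (inverse x * inverse x)) (- {0})" for v :: real
      by (intro Ck_on_bounded_linear_compose[OF bounded_linear_mult_right]) auto
    then show "Ck_on k (\<lambda>x. - (inverse x * v * inverse x)) (- {0})" for v :: real
      by (simp add: algebra_simps)
  qed (auto intro: has_derivative_inverse')
qed

lemma smooth_on_divide:
  fixes f g :: "'e::euclidean_space \<Rightarrow> real"
  assumes "open S" "smooth_on f S" "smooth_on g S" "\<And>x. x \<in> S \<Longrightarrow> g x \<noteq> 0"
  shows "smooth_on (\<lambda>x. f x / g x) S"
proof -
  have "smooth_on (\<lambda>x. inverse (g x)) S"
    using assms by (intro smooth_on_compose[of S "- {0}" g inverse])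
      (auto simp: smooth_on_def Ck_on_inverse)
  then show ?thesis using smooth_on_mult[OF assms(1,2)] by (simp add: divide_inverse)
qed

section \<open>Flat functions and smooth cutoffs\<close>

text \<open>The classical flat function exp(-1/t), divided by powers of t. The parameter
  \<open>m\<close> is present because differentiation raises it: the span of the family is closed
  under derivatives, so all orders are treated at once.\<close>

definition exp_flat :: "nat \<Rightarrow> real \<Rightarrow> real" where
  "exp_flat m t = (if t > 0 then exp (- inverse t) * inverse t ^ m else 0)"

text \<open>With s = 1/t this is the decay of s^m / exp s as s grows.\<close>

lemma exp_flat_tendsto_0: "(exp_flat m \<longlongrightarrow> 0) (at 0)"
proof -
  have "((\<lambda>t. inverse t ^ m / exp (inverse t)) \<longlongrightarrow> 0) (at_right (0 :: real))"
    by (rule filterlim_compose[OF tendsto_power_div_exp_0 filterlim_inverse_at_top_right])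
  moreover have "eventually (\<lambda>t. inverse t ^ m / exp (inverse t) = exp_flat m t) (at_right 0)"
    by (auto simp: eventually_at_filter exp_flat_def exp_minus field_simps)
  ultimately have "(exp_flat m \<longlongrightarrow> 0) (at_right 0)"
    by (rule Lim_transform_eventually)
  moreover have "(exp_flat m \<longlongrightarrow> 0) (at_left 0)"
    by (rule Lim_transform_eventually[OF tendsto_const])
      (auto simp: eventually_at_filter exp_flat_def)
  ultimately show ?thesis by (simp add: filterlim_at_split)
qed

lemma exp_flat_has_real_derivative:
  "(exp_flat m has_real_derivative exp_flat (m + 2) t - m * exp_flat (m + 1) t) (at t)"
proof -
  consider "t > 0" | "t = 0" | "t < 0" by linarith
  then show ?thesis
  proof cases
    case 1
    have pw: "k = 0 \<or> inverse t ^ k = inverse t * inverse t ^ (k - Suc 0)" for k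
      by (cases k) auto
    have "((\<lambda>t. exp (- inverse t) * inverse t ^ m) has_real_derivative
        exp_flat (m + 2) t - m * exp_flat (m + 1) t) (at t)"
      using 1 pw[of "m - 1"]
      by (cases m) (auto intro!: derivative_eq_intros simp: exp_flat_def power2_eq_square algebra_simps)
    then show ?thesis
      by (rule has_field_derivative_transform_within_open[where S = "{0<..}"])
        (use 1 in \<open>auto simp: exp_flat_def\<close>)
  next
    case 2
    \<comment> \<open>Away from 0 the difference quotient of \<open>exp_flat m\<close> based at 0 is
      \<open>exp_flat (m + 1)\<close>, so the derivative at 0 is the previous limit one exponent
      higher.\<close>
    have "(\<lambda>h. (exp_flat m (0 + h) - exp_flat m 0) / h) \<midarrow>0\<rightarrow> 0"
      using exp_flat_tendsto_0[of "m + 1"]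
      by (rule Lim_transform_eventually) (auto simp: eventually_at_filter exp_flat_def field_simps)
    then show ?thesis using 2 by (simp add: DERIV_def exp_flat_def)
  next
    case 3
    have "(exp_flat m has_real_derivative 0) (at t)"
      by (rule has_field_derivative_transform_within_open[where S = "{..<0}" and f = "\<lambda>_. 0"])
        (use 3 in \<open>auto simp: exp_flat_def\<close>)
    then show ?thesis using 3 by (simp add: exp_flat_def)
  qed
qed

lemma Ck_on_exp_flat: "Ck_on k (exp_flat m) UNIV"
proof (induction k arbitrary: m)
  case 0
  show ?case
    by (auto intro!: continuous_at_imp_continuous_on DERIV_isCont exp_flat_has_real_derivative)
next
  case (Suc k)
  have 1: "Ck_on k (\<lambda>t. c * exp_flat m t) UNIV" for c m
    by (rule Ck_on_bounded_linear_compose[OF bounded_linear_mult_right _ Suc]) auto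
  show ?case
  proof (rule Ck_on_SucI[where f' = "\<lambda>t v. v * exp_flat (m + 2) t + (- v * m) * exp_flat (m + 1) t"])
    show "(exp_flat m has_derivative (\<lambda>v. v * exp_flat (m + 2) t + (- v * m) * exp_flat (m + 1) t)) (at t)" for t
      using exp_flat_has_real_derivative[of m t] unfolding has_field_derivative_def
      by (rule has_derivative_eq_rhs) (simp add: fun_eq_iff algebra_simps)
    show "Ck_on k (\<lambda>t. v * exp_flat (m + 2) t + (- v * m) * exp_flat (m + 1) t) UNIV" for v
      by (intro Ck_on_add 1 open_UNIV)
  qed simp
qed

lemma smooth_on_exp_flat: "smooth_on (exp_flat m) UNIV"
  by (simp add: smooth_on_def Ck_on_exp_flat)

text \<open>The function is the quotient p / (p + q), where p vanishes from radius 2 r outwards and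
  q up to radius r, so that the denominator is always positive. Both depend on the squared distance,
  which unlike the distance is smooth at the centre.\<close>

lemma smooth_bump:
  fixes a :: "'e::euclidean_space"
  assumes "r > 0"
  shows "\<exists>\<rho> :: 'e \<Rightarrow> real. smooth_on \<rho> UNIV \<and> (\<forall>x. dist a x \<le> r \<longrightarrow> \<rho> x = 1) \<and>
    (\<forall>x. dist a x \<ge> 2 * r \<longrightarrow> \<rho> x = 0)"
proof -
  define s where "s x = (x - a) \<bullet> (x - a)" for x
  have s: "s x = (dist a x)\<^sup>2" for x
    by (simp add: s_def dist_norm norm_minus_commute[of a] power2_norm_eq_inner)
  define p where "p x = exp_flat 0 (4 * r\<^sup>2 - s x)" for x
  define q where "q x = exp_flat 0 (s x - r\<^sup>2)" for x
  have smooth_s: "smooth_on s UNIV"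
    unfolding s_def
    by (intro smooth_on_bilinear[OF bounded_bilinear_inner] smooth_on_diff smooth_on_id smooth_on_const) auto
  have smooth_p: "smooth_on p UNIV"
    unfolding p_def
    by (rule smooth_on_compose[OF _ _ _ _ smooth_on_exp_flat])
      (auto intro!: smooth_on_diff smooth_on_const smooth_s)
  have smooth_q: "smooth_on q UNIV"
    unfolding q_def
    by (rule smooth_on_compose[OF _ _ _ _ smooth_on_exp_flat])
      (auto intro!: smooth_on_diff smooth_on_const smooth_s)
  have "p x + q x > 0" for x
  proof (cases "s x < 4 * r\<^sup>2")
    case False
    moreover have "0 < r\<^sup>2" using assms by simp
    ultimately have "r\<^sup>2 < s x" by linarith
    then show ?thesis by (auto simp: p_def q_def exp_flat_def add_nonneg_pos)
  qed (auto simp: p_def q_def exp_flat_def add_pos_nonneg)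
  then have nz: "p x + q x \<noteq> 0" for x by (metis less_irrefl)
  show ?thesis
  proof (intro exI[of _ "\<lambda>x. p x / (p x + q x)"] conjI allI impI)
    show "smooth_on (\<lambda>x. p x / (p x + q x)) UNIV"
      by (intro smooth_on_divide smooth_on_add smooth_p smooth_q nz) auto
    show "p x / (p x + q x) = 1" if "dist a x \<le> r" for x
    proof -
      have "s x \<le> r\<^sup>2" unfolding s using that by (simp add: power_mono)
      then have "q x = 0" by (simp add: q_def exp_flat_def)
      then show ?thesis using nz[of x] by simp
    qed
    show "p x / (p x + q x) = 0" if "dist a x \<ge> 2 * r" for x
    proof -
      have "(2 * r)\<^sup>2 \<le> s x" unfolding s using that assms by (intro power_mono) auto
      then show ?thesis by (simp add: p_def exp_flat_def power_mult_distrib)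
    qed
  qed
qed

section \<open>Hadamard's lemma and the symmetry of second derivatives\<close>

lemma continuous_on_slice:
  assumes "continuous_on (S \<times> T) (\<lambda>(x, t). F x t)" "x \<in> S"
  shows "continuous_on T (F x)"
proof -
  have "continuous_on T (\<lambda>t. case (x, t) of (x, t) \<Rightarrow> F x t)"
    by (rule continuous_on_compose2[OF assms(1)]) (auto intro!: continuous_intros assms(2))
  then show ?thesis by simp
qed

text \<open>Each differentiation under the integral sign contributes one factor \<open>t\<close>, hence the weight \<open>t ^ m\<close>.\<close>

definition segment_moment :: "'e::euclidean_space \<Rightarrow> nat \<Rightarrow> ('e \<Rightarrow> real) \<Rightarrow> 'e \<Rightarrow> real" where
  "segment_moment a m h x = integral (cbox 0 1) (\<lambda>t. t ^ m * h (a + t *\<^sub>R (x - a)))"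

context
  fixes W :: "'e::euclidean_space set" and a :: 'e
  assumes W: "open W" "convex W" "a \<in> W"
begin

lemma segment_in:
  assumes "x \<in> W" "t \<in> {0..1}"
  shows "a + t *\<^sub>R (x - a) \<in> W"
proof -
  have "(1 - t) *\<^sub>R a + t *\<^sub>R x \<in> W"
    using W assms by (intro convexD_alt) auto
  then show ?thesis by (simp add: algebra_simps)
qed

lemma continuous_on_segment_integrand:
  fixes h :: "'e \<Rightarrow> real"
  assumes "continuous_on W h"
  shows "continuous_on (W \<times> cbox 0 1) (\<lambda>(x, t). t ^ m * h (a + t *\<^sub>R (x - a)))"
  unfolding split_beta
  by (intro continuous_intros continuous_on_compose2[OF assms])
    (auto intro: segment_in[simplified])

text \<open>A directional derivative of a segment moment is again a segment moment, of the
  directional derivative of \<open>h\<close>; hence the induction runs with \<open>m\<close> and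
  \<open>h\<close> arbitrary.\<close>

lemma Ck_on_segment_moment:
  assumes "smooth_on h W"
  shows "Ck_on k (segment_moment a m h) W"
  using assms
proof (induction k arbitrary: m h)
  case 0
  then show ?case
    unfolding Ck_on.simps segment_moment_def
    by (intro integral_continuous_on_param continuous_on_segment_integrand smooth_on_imp_continuous_on)
next
  case (Suc k)
  let ?dh = "\<lambda>x. frechet_derivative h (at x)"
  \<comment> \<open>\<open>leibniz_rule\<close> expects the derivative of the integrand as a
    continuous map into the bounded linear maps; in finite dimension its continuity can be checked
    one direction at a time.\<close>
  let ?F = "\<lambda>x t. Blinfun (\<lambda>v. t ^ Suc m * ?dh (a + t *\<^sub>R (x - a)) v)"
  have bl: "bounded_linear (\<lambda>v. t ^ Suc m * ?dh (a + t *\<^sub>R (x - a)) v)" if "x \<in> W" "t \<in> cbox 0 1" for x t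
    using smooth_on_has_derivative[OF Suc.prems segment_in] that
    by (intro bounded_linear_const_mult has_derivative_bounded_linear) auto
  note app = bounded_linear_Blinfun_apply[OF bl]
  have dh: "continuous_on (W \<times> cbox 0 1) (\<lambda>(x, t). t ^ Suc m * ?dh (a + t *\<^sub>R (x - a)) v)" for v
    by (rule continuous_on_segment_integrand)
      (rule smooth_on_imp_continuous_on[OF smooth_on_derivative[OF Suc.prems]])
  have contF: "continuous_on (W \<times> cbox 0 1) (\<lambda>(x, t). ?F x t)"
  proof (rule continuous_on_blinfun_componentwise)
    fix v :: 'e
    show "continuous_on (W \<times> cbox 0 1) (\<lambda>z. blinfun_apply (case z of (x, t) \<Rightarrow> ?F x t) v)"
      by (rule continuous_on_eq[OF dh[of v]]) (use app in auto)
  qed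
  have der: "(segment_moment a m h has_derivative (\<lambda>v. segment_moment a (Suc m) (\<lambda>y. ?dh y v) x)) (at x)"
    if x: "x \<in> W" for x
  proof -
    have int: "?F x integrable_on cbox 0 1"
      by (rule integrable_continuous)
        (rule continuous_on_slice[OF contF x])
    have "(segment_moment a m h has_derivative blinfun_apply (integral (cbox 0 1) (?F x))) (at x within W)"
      unfolding segment_moment_def
    proof (rule leibniz_rule[OF _ _ contF x W(2)])
      fix y and t :: real assume y: "y \<in> W" "t \<in> cbox 0 1"
      have "(h has_derivative ?dh (a + t *\<^sub>R (y - a))) (at (a + t *\<^sub>R (y - a)))"
        using smooth_on_has_derivative[OF Suc.prems segment_in] y by auto
      moreover have "((\<lambda>x. a + t *\<^sub>R (x - a)) has_derivative (\<lambda>v. t *\<^sub>R v)) (at y within W)"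
        by (auto intro!: derivative_eq_intros)
      ultimately have "((\<lambda>x. h (a + t *\<^sub>R (x - a))) has_derivative
          (\<lambda>v. ?dh (a + t *\<^sub>R (y - a)) (t *\<^sub>R v))) (at y within W)"
        by (rule has_derivative_compose[rotated])
      moreover have "?dh (a + t *\<^sub>R (y - a)) (t *\<^sub>R v) = t * ?dh (a + t *\<^sub>R (y - a)) v" for v
        using linear_cmul[OF bounded_linear.linear[OF has_derivative_bounded_linear[OF smooth_on_has_derivative[OF Suc.prems segment_in[OF y(1)]]]]] y
        by auto
      ultimately have "((\<lambda>x. h (a + t *\<^sub>R (x - a))) has_derivative
          (\<lambda>v. t * ?dh (a + t *\<^sub>R (y - a)) v)) (at y within W)" by simp
      from has_derivative_mult_right[OF this, of "t ^ m"]
      show "((\<lambda>x. t ^ m * h (a + t *\<^sub>R (x - a))) has_derivative blinfun_apply (?F y t)) (at y within W)"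
        unfolding app[OF y] by (simp add: mult_ac)
    next
      fix y assume y: "y \<in> W"
      show "(\<lambda>t. t ^ m * h (a + t *\<^sub>R (y - a))) integrable_on cbox 0 1"
        by (rule integrable_continuous)
          (rule continuous_on_slice[OF continuous_on_segment_integrand[OF smooth_on_imp_continuous_on[OF Suc.prems]] y])
    qed
    moreover have "blinfun_apply (integral (cbox 0 1) (?F x)) = (\<lambda>v. segment_moment a (Suc m) (\<lambda>y. ?dh y v) x)"
    proof
      fix v
      have "blinfun_apply (integral (cbox 0 1) (?F x)) v = integral (cbox 0 1) (\<lambda>t. blinfun_apply (?F x t) v)"
        using integral_linear[OF int blinfun.bounded_linear_left] by (simp add: o_def)
      also have "\<dots> = segment_moment a (Suc m) (\<lambda>y. ?dh y v) x"
        unfolding segment_moment_def by (intro integral_cong) (use app[OF x] in auto)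
      finally show "blinfun_apply (integral (cbox 0 1) (?F x)) v = segment_moment a (Suc m) (\<lambda>y. ?dh y v) x" .
    qed
    ultimately show ?thesis unfolding at_within_open[OF x W(1)] by metis
  qed
  show ?case
    by (rule Ck_on_SucI[OF W(1) der]) (auto intro: Suc.IH smooth_on_derivative Suc.prems)
qed

text \<open>The fundamental theorem of calculus along the segment from \<open>a\<close> to
  \<open>x\<close>. The coefficient \<open>g i x\<close> is the mean over that segment of the
  derivative of \<open>f\<close> in direction \<open>i\<close>, which explains its value at
  \<open>a\<close>.\<close>

lemma Hadamard_lemma:
  fixes f :: "'e \<Rightarrow> real"
  assumes f: "smooth_on f W"
  shows "\<exists>g. (\<forall>i. smooth_on (g i) W \<and> g i a = frechet_derivative f (at a) i) \<and>
    (\<forall>x\<in>W. f x = f a + (\<Sum>i\<in>Basis. ((x - a) \<bullet> i) * g i x))"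
proof -
  let ?df = "\<lambda>x. frechet_derivative f (at x)"
  let ?g = "\<lambda>i. segment_moment a 0 (\<lambda>x. ?df x i)"
  have "f x = f a + (\<Sum>i\<in>Basis. ((x - a) \<bullet> i) * ?g i x)" if x: "x \<in> W" for x
  proof -
  have "((\<lambda>t. ?df (a + t *\<^sub>R (x - a)) (x - a)) has_integral f (a + 1 *\<^sub>R (x - a)) - f (a + 0 *\<^sub>R (x - a))) {0..1}"
  proof (rule fundamental_theorem_of_calculus)
    fix t :: real assume t: "t \<in> {0..1}"
    have d: "(f has_derivative ?df (a + t *\<^sub>R (x - a))) (at (a + t *\<^sub>R (x - a)))"
      using smooth_on_has_derivative[OF f segment_in[OF x t]] .
    have "((\<lambda>t. a + t *\<^sub>R (x - a)) has_derivative (\<lambda>s. s *\<^sub>R (x - a))) (at t within {0..1})"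
      by (auto intro!: derivative_eq_intros)
    from has_derivative_compose[OF this d]
    show "((\<lambda>t. f (a + t *\<^sub>R (x - a))) has_vector_derivative ?df (a + t *\<^sub>R (x - a)) (x - a)) (at t within {0..1})"
      using has_derivative_bounded_linear[OF d] by (simp add: has_vector_derivative_def linear_simps)
  qed auto
  then have "f x - f a = integral (cbox 0 1) (\<lambda>t. ?df (a + t *\<^sub>R (x - a)) (x - a))"
    by (auto simp: integral_unique)
  also have "\<dots> = integral (cbox 0 1) (\<lambda>t. \<Sum>i\<in>Basis. ((x - a) \<bullet> i) * ?df (a + t *\<^sub>R (x - a)) i)"
  proof (intro integral_cong)
    fix t :: real assume "t \<in> cbox 0 1"
    then show "?df (a + t *\<^sub>R (x - a)) (x - a) = (\<Sum>i\<in>Basis. ((x - a) \<bullet> i) * ?df (a + t *\<^sub>R (x - a)) i)"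
      using derivative_basis_expansion[OF has_derivative_bounded_linear[OF smooth_on_has_derivative[OF f segment_in[OF x]]], of t "x - a"]
      by simp
  qed
  also have "\<dots> = (\<Sum>i\<in>Basis. integral (cbox 0 1) (\<lambda>t. ((x - a) \<bullet> i) * ?df (a + t *\<^sub>R (x - a)) i))"
  proof (intro integral_sum)
    fix i :: 'e
    have "(\<lambda>t. t ^ 0 * ?df (a + t *\<^sub>R (x - a)) i) integrable_on cbox 0 1"
      by (rule integrable_continuous, rule continuous_on_slice[OF continuous_on_segment_integrand x])
        (rule smooth_on_imp_continuous_on[OF smooth_on_derivative[OF f]])
    then show "(\<lambda>t. ((x - a) \<bullet> i) * ?df (a + t *\<^sub>R (x - a)) i) integrable_on cbox 0 1"
      by (intro integrable_on_mult_right) simp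
  qed auto
  finally have "f x - f a = (\<Sum>i\<in>Basis. ((x - a) \<bullet> i) * ?g i x)"
    by (simp add: segment_moment_def)
  then show ?thesis by simp
  qed
  moreover have "smooth_on (?g i) W" for i
    using Ck_on_segment_moment[OF smooth_on_derivative[OF f]] by (simp add: smooth_on_def)
  moreover have "?g i a = ?df a i" for i by (simp add: segment_moment_def)
  ultimately show ?thesis by (intro exI[of _ ?g]) blast
qed

end

text \<open>No differentiability is required: nearby equal functions have the same set of
  derivatives, so the choice operator picks the same one.\<close>

lemma frechet_derivative_cong:
  assumes "open N" "a \<in> N" "\<And>x. x \<in> N \<Longrightarrow> f x = g x"
  shows "frechet_derivative f (at a) = frechet_derivative g (at a)"
proof -
  have "(f has_derivative f') (at a) \<longleftrightarrow> (g has_derivative f') (at a)" for f'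
    using assms has_derivative_transform_within_open[of f f' a UNIV N g]
      has_derivative_transform_within_open[of g f' a UNIV N f] by auto
  then show ?thesis unfolding frechet_derivative_def by simp
qed

text \<open>Hadamard's expansion makes the symmetry visible. When it is differentiated twice, every
  second derivative of a coefficient carries a factor \<open>x - a\<close> that vanishes at
  \<open>a\<close>, and the remaining sum is symmetric in \<open>u\<close> and
  \<open>v\<close>.\<close>

lemma second_derivative_symmetric:
  fixes f :: "'e::euclidean_space \<Rightarrow> real"
  assumes "open S" "smooth_on f S" "a \<in> S"
  shows "frechet_derivative (\<lambda>x. frechet_derivative f (at x) u) (at a) v =
    frechet_derivative (\<lambda>x. frechet_derivative f (at x) v) (at a) u"
proof -
  obtain r where r: "r > 0" "ball a r \<subseteq> S" using openE[OF assms(1,3)] .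
  let ?W = "ball a r"
  have f: "smooth_on f ?W" using assms(2) r(2) by (rule smooth_on_subset)
  have a: "a \<in> ?W" using r by simp
  obtain g where g: "\<And>i. smooth_on (g i) ?W"
    and eq: "\<And>x. x \<in> ?W \<Longrightarrow> f x = f a + (\<Sum>i\<in>Basis. ((x - a) \<bullet> i) * g i x)"
    using Hadamard_lemma[OF open_ball convex_ball a f] by blast
  let ?dg = "\<lambda>i x. frechet_derivative (g i) (at x)"
  have df: "frechet_derivative f (at x) u = (\<Sum>i\<in>Basis. ((x - a) \<bullet> i) * ?dg i x u + (u \<bullet> i) * g i x)"
    if x: "x \<in> ?W" for x u
  proof -
    have "((\<lambda>x. f a + (\<Sum>i\<in>Basis. ((x - a) \<bullet> i) * g i x)) has_derivative
        (\<lambda>u. \<Sum>i\<in>Basis. ((x - a) \<bullet> i) * ?dg i x u + (u \<bullet> i) * g i x)) (at x)"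
      by (auto intro!: derivative_eq_intros smooth_on_has_derivative[OF g x])
    then have "(f has_derivative (\<lambda>u. \<Sum>i\<in>Basis. ((x - a) \<bullet> i) * ?dg i x u + (u \<bullet> i) * g i x)) (at x)"
      by (rule has_derivative_transform_within_open[of _ _ _ _ ?W]) (use eq x in auto)
    from frechet_derivative_at[OF this, symmetric] show ?thesis by simp
  qed
  have "frechet_derivative (\<lambda>x. frechet_derivative f (at x) u) (at a) v =
      (\<Sum>i\<in>Basis. (v \<bullet> i) * ?dg i a u + (u \<bullet> i) * ?dg i a v)" for u v
  proof -
    have "((\<lambda>x. \<Sum>i\<in>Basis. ((x - a) \<bullet> i) * ?dg i x u + (u \<bullet> i) * g i x) has_derivative
        (\<lambda>v. \<Sum>i\<in>Basis. (v \<bullet> i) * ?dg i a u + (u \<bullet> i) * ?dg i a v)) (at a)"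
      by (auto intro!: derivative_eq_intros smooth_on_has_derivative[OF g a]
          smooth_on_has_derivative[OF smooth_on_derivative[OF g] a])
    then have "((\<lambda>x. frechet_derivative f (at x) u) has_derivative
        (\<lambda>v. \<Sum>i\<in>Basis. (v \<bullet> i) * ?dg i a u + (u \<bullet> i) * ?dg i a v)) (at a)"
      by (rule has_derivative_transform_within_open[of _ _ _ _ ?W]) (use df a in auto)
    from frechet_derivative_at[OF this, symmetric] show ?thesis by simp
  qed
  then show ?thesis by (simp add: add.commute)
qed

section \<open>Smooth atlases\<close>

lemma plus_comp: "(f + g) \<circ> h = (\<lambda>x. (f \<circ> h) x + (g \<circ> h) x)"
  by (simp add: fun_eq_iff)

lemma times_comp: "(f * g) \<circ> h = (\<lambda>x. (f \<circ> h) x * (g \<circ> h) x)"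
  by (simp add: fun_eq_iff)

text \<open>The manifold axioms apart from the two topological ones. The tangent atlas is shown to
  satisfy these first, so that its topology can be described in charts before it is proved Hausdorff
  and second countable.\<close>

locale smooth_atlas =
  fixes A :: "('a, 'e::euclidean_space) chart set"
  assumes inj_chart: "(U, \<phi>) \<in> A \<Longrightarrow> inj_on \<phi> U"
    and open_overlap: "(U, \<phi>) \<in> A \<Longrightarrow> (V, \<psi>) \<in> A \<Longrightarrow> open (\<phi> ` (U \<inter> V))"
    and smooth_transition:
      "(U, \<phi>) \<in> A \<Longrightarrow> (V, \<psi>) \<in> A \<Longrightarrow> smooth_on (\<psi> \<circ> inv_into U \<phi>) (\<phi> ` (U \<inter> V))"
begin

lemma open_chart_image: "(U, \<phi>) \<in> A \<Longrightarrow> open (\<phi> ` U)"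
  using open_overlap[of U \<phi> U \<phi>] by simp

lemma inv_chart: "(U, \<phi>) \<in> A \<Longrightarrow> p \<in> U \<Longrightarrow> inv_into U \<phi> (\<phi> p) = p"
  using inj_chart inv_into_f_f by metis

lemma point_in_chart:
  assumes "p \<in> points A"
  obtains U \<phi> where "(U, \<phi>) \<in> A" "p \<in> U"
  using assms unfolding points_def by fastforce

lemma chart_subset_points: "(U, \<phi>) \<in> A \<Longrightarrow> U \<subseteq> points A"
  unfolding points_def by force

lemma open_transition_preimage:
  assumes U: "(U, \<phi>) \<in> A" and V: "(V, \<psi>) \<in> A" and S: "open S"
  shows "open (\<psi> ` (V \<inter> {x \<in> U. \<phi> x \<in> S}))"
proof -
  have "\<psi> ` (V \<inter> {x \<in> U. \<phi> x \<in> S}) = \<psi> ` (V \<inter> U) \<inter> (\<phi> \<circ> inv_into V \<psi>) -` S"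
    using inv_chart[OF V] by auto
  moreover have "continuous_on (\<psi> ` (V \<inter> U)) (\<phi> \<circ> inv_into V \<psi>)"
    using smooth_on_imp_continuous_on[OF smooth_transition[OF V U]] .
  ultimately show ?thesis
    using continuous_openin_preimage_gen[OF _ S] open_overlap[OF V U] openin_open_trans by metis
qed

lemma openin_chart_preimage:
  "(U, \<phi>) \<in> A \<Longrightarrow> open S \<Longrightarrow> openin (atlas_topology A) {x \<in> U. \<phi> x \<in> S}"
  unfolding atlas_topology_def by (rule topology_generated_by_Basis) auto

lemma openin_chart: "(U, \<phi>) \<in> A \<Longrightarrow> openin (atlas_topology A) U"
  using openin_chart_preimage[of U \<phi> UNIV] by simp

lemma topspace_atlas: "topspace (atlas_topology A) = points A"
proof -
  have "topspace (atlas_topology A) \<subseteq> points A"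
    unfolding atlas_topology_def topology_generated_by_topspace
    using chart_subset_points by blast
  moreover have "points A \<subseteq> topspace (atlas_topology A)"
    using openin_subset[OF openin_chart] point_in_chart by (metis subset_iff)
  ultimately show ?thesis by blast
qed

text \<open>Chart images of the generating sets are open by continuity of the transitions, and
  injectivity of charts makes images commute with intersections, so openness survives generation.
  Conversely, an open chart image pulls back to a neighbourhood inside \<open>X\<close>.\<close>

lemma openin_atlas_iff:
  "openin (atlas_topology A) X \<longleftrightarrow> X \<subseteq> points A \<and> (\<forall>(U, \<phi>) \<in> A. open (\<phi> ` (U \<inter> X)))"
proof
  assume X: "openin (atlas_topology A) X"
  have "open (\<phi> ` (U \<inter> X))" if U: "(U, \<phi>) \<in> A" for U \<phi>
    using X unfolding atlas_topology_def openin_topology_generated_by_iff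
  proof (induction rule: generate_topology_on.induct)
    case (Int a b)
    have "\<phi> ` (U \<inter> (a \<inter> b)) = \<phi> ` (U \<inter> a) \<inter> \<phi> ` (U \<inter> b)"
      using inj_chart[OF U] by (auto simp: inj_on_def)
    then show ?case using Int by auto
  next
    case (UN K)
    have "\<phi> ` (U \<inter> \<Union> K) = (\<Union>k\<in>K. \<phi> ` (U \<inter> k))" by auto
    then show ?case using UN by auto
  next
    case (Basis s)
    then show ?case using open_transition_preimage[OF _ U] by auto
  qed auto
  then show "X \<subseteq> points A \<and> (\<forall>(U, \<phi>) \<in> A. open (\<phi> ` (U \<inter> X)))"
    using openin_subset[OF X] topspace_atlas by auto
next
  assume X: "X \<subseteq> points A \<and> (\<forall>(U, \<phi>) \<in> A. open (\<phi> ` (U \<inter> X)))"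
  show "openin (atlas_topology A) X"
  proof (subst openin_subopen, intro ballI)
    fix p assume "p \<in> X"
    then obtain U \<phi> where U: "(U, \<phi>) \<in> A" "p \<in> U" using X point_in_chart by blast
    have "{x \<in> U. \<phi> x \<in> \<phi> ` (U \<inter> X)} \<subseteq> X"
      using inj_chart[OF U(1)] by (auto simp: inj_on_def)
    moreover have "openin (atlas_topology A) {x \<in> U. \<phi> x \<in> \<phi> ` (U \<inter> X)}"
      using X U by (intro openin_chart_preimage) auto
    ultimately show "\<exists>T. openin (atlas_topology A) T \<and> p \<in> T \<and> T \<subseteq> X"
      using U \<open>p \<in> X\<close> by (intro exI[of _ "{x \<in> U. \<phi> x \<in> \<phi> ` (U \<inter> X)}"]) auto
  qed
qed

lemma open_image_chart:
  "openin (atlas_topology A) X \<Longrightarrow> (U, \<phi>) \<in> A \<Longrightarrow> open (\<phi> ` (U \<inter> X))"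
  using openin_atlas_iff by fastforce

lemma continuous_map_inv_chart:
  assumes U: "(U, \<phi>) \<in> A"
  shows "continuous_map (top_of_set (\<phi> ` U)) (atlas_topology A) (inv_into U \<phi>)"
  unfolding continuous_map_def
proof (intro conjI allI impI)
  show "inv_into U \<phi> \<in> topspace (top_of_set (\<phi> ` U)) \<rightarrow> topspace (atlas_topology A)"
    using chart_subset_points[OF U] by (auto simp: topspace_atlas inv_chart[OF U])
  fix X assume X: "openin (atlas_topology A) X"
  have "{x \<in> \<phi> ` U. inv_into U \<phi> x \<in> X} = \<phi> ` (U \<inter> X)"
    by (auto simp: inv_chart[OF U])
  then show "openin (top_of_set (\<phi> ` U)) {x \<in> topspace (top_of_set (\<phi> ` U)). inv_into U \<phi> x \<in> X}"
    using open_image_chart[OF X U] by (auto intro: open_subset)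
qed

lemma smooth_chart_transfer:
  assumes U: "(U, \<phi>) \<in> A" and V: "(V, \<psi>) \<in> A" and X: "openin (atlas_topology A) X"
    and f: "smooth_on (f \<circ> inv_into U \<phi>) (\<phi> ` (U \<inter> X))"
  shows "smooth_on (f \<circ> inv_into V \<psi>) (\<psi> ` (V \<inter> (U \<inter> X)))"
proof (rule smooth_on_cong)
  have UX: "openin (atlas_topology A) (U \<inter> X)" by (intro openin_Int openin_chart[OF U] X)
  show o: "open (\<psi> ` (V \<inter> (U \<inter> X)))" by (rule open_image_chart[OF UX V])
  show "smooth_on (\<lambda>x. (f \<circ> inv_into U \<phi>) ((\<phi> \<circ> inv_into V \<psi>) x)) (\<psi> ` (V \<inter> (U \<inter> X)))"
  proof (rule smooth_on_compose[OF o open_image_chart[OF X U] _ _ f])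
    show "smooth_on (\<phi> \<circ> inv_into V \<psi>) (\<psi> ` (V \<inter> (U \<inter> X)))"
      by (rule smooth_on_subset[OF smooth_transition[OF V U]]) auto
  qed (auto simp: inv_chart[OF V])
qed (auto simp: inv_chart[OF U] inv_chart[OF V])

lemma smooth_functions_zero: "f \<in> smooth_functions A \<Longrightarrow> p \<notin> points A \<Longrightarrow> f p = 0"
  unfolding smooth_functions_def by blast

lemma smooth_functions_chart:
  "f \<in> smooth_functions A \<Longrightarrow> (U, \<phi>) \<in> A \<Longrightarrow> smooth_on (f \<circ> inv_into U \<phi>) (\<phi> ` U)"
  unfolding smooth_functions_def by blast

text \<open>Transitions carry smoothness from one chart to any other, so near each point a single
  chart of choice is enough.\<close>

lemma smooth_functionsI:
  assumes "\<And>p. p \<notin> points A \<Longrightarrow> f p = 0"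
    and local: "\<And>p. p \<in> points A \<Longrightarrow> \<exists>U \<phi> X. (U, \<phi>) \<in> A \<and> openin (atlas_topology A) X \<and>
      p \<in> U \<inter> X \<and> smooth_on (f \<circ> inv_into U \<phi>) (\<phi> ` (U \<inter> X))"
  shows "f \<in> smooth_functions A"
proof -
  have "smooth_on (f \<circ> inv_into V \<psi>) (\<psi> ` V)" if V: "(V, \<psi>) \<in> A" for V \<psi>
  proof (rule smooth_on_local)
    fix x assume "x \<in> \<psi> ` V"
    then obtain p where p: "p \<in> V" "x = \<psi> p" by blast
    then obtain U \<phi> X where U: "(U, \<phi>) \<in> A" "openin (atlas_topology A) X"
      "p \<in> U \<inter> X" "smooth_on (f \<circ> inv_into U \<phi>) (\<phi> ` (U \<inter> X))"
      using local chart_subset_points[OF V] by blast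
    have "open (\<psi> ` (V \<inter> (U \<inter> X)))"
      by (intro open_image_chart[OF _ V] openin_Int openin_chart[OF U(1)] U(2))
    then show "\<exists>N. open N \<and> x \<in> N \<and> smooth_on (f \<circ> inv_into V \<psi>) N"
      using smooth_chart_transfer[OF U(1) V U(2,4)] p U(3) by blast
  qed
  then show ?thesis using assms(1) unfolding smooth_functions_def by auto
qed

lemma smooth_functions_iff:
  "f \<in> smooth_functions A \<longleftrightarrow> (\<forall>x. x \<notin> points A \<longrightarrow> f x = 0) \<and>
    (\<forall>U \<phi>. (U, \<phi>) \<in> A \<longrightarrow> smooth_on (\<lambda>x. f (inv_into U \<phi> x)) (\<phi> ` U))"
  unfolding smooth_functions_def by (auto simp: o_def)

lemma smooth_functions_0: "0 \<in> smooth_functions A"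
  unfolding smooth_functions_iff by (simp add: smooth_on_const open_chart_image)

lemma smooth_functions_add:
  "f \<in> smooth_functions A \<Longrightarrow> g \<in> smooth_functions A \<Longrightarrow> f + g \<in> smooth_functions A"
  unfolding smooth_functions_iff by (auto intro!: smooth_on_add open_chart_image)

lemma smooth_functions_mult:
  "f \<in> smooth_functions A \<Longrightarrow> g \<in> smooth_functions A \<Longrightarrow> f * g \<in> smooth_functions A"
  unfolding smooth_functions_iff by (auto intro!: smooth_on_mult open_chart_image)

lemma smooth_functions_scale:
  "f \<in> smooth_functions A \<Longrightarrow> (\<lambda>x. c * f x) \<in> smooth_functions A"
  unfolding smooth_functions_iff by (auto intro!: smooth_on_mult smooth_on_const open_chart_image)

lemma smooth_functions_sum:
  "(\<And>i. i \<in> I \<Longrightarrow> f i \<in> smooth_functions A) \<Longrightarrow> (\<Sum>i\<in>I. f i) \<in> smooth_functions A"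
  by (induction I rule: infinite_finite_induct) (auto intro: smooth_functions_0 smooth_functions_add)

lemma smooth_functions_minus: "f \<in> smooth_functions A \<Longrightarrow> - f \<in> smooth_functions A"
  using smooth_functions_scale[of f "-1"] by (simp add: fun_Compl_def)

end

lemma smooth_manifold_iff:
  "smooth_manifold A \<longleftrightarrow>
    smooth_atlas A \<and> Hausdorff_space (atlas_topology A) \<and> second_countable (atlas_topology A)"
  unfolding smooth_manifold_def smooth_atlas_def by blast

sublocale smooth_manifold \<subseteq> smooth_atlas
  using smooth_manifold_axioms smooth_manifold_iff by blast

context smooth_manifold
begin

text \<open>The local function is multiplied by a cutoff that is 1 up to radius e/2 and 0 from
  radius e on. The extension by zero is smooth because the preimage of the closed ball is compact,
  hence closed in a Hausdorff space, so that its complement is an open set on which the extension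
  vanishes.\<close>

lemma smooth_extension:
  assumes U: "(U, \<phi>) \<in> A" and p: "p \<in> U" and W: "open W" "\<phi> p \<in> W" "W \<subseteq> \<phi> ` U"
    and h: "smooth_on h W"
  obtains f N where "f \<in> smooth_functions A" "open N" "\<phi> p \<in> N" "N \<subseteq> W"
    "\<And>q. q \<in> U \<Longrightarrow> \<phi> q \<in> N \<Longrightarrow> f q = h (\<phi> q)"
    "\<And>q. \<not> (q \<in> U \<and> \<phi> q \<in> W) \<Longrightarrow> f q = 0"
proof -
  obtain e where e: "e > 0" "cball (\<phi> p) e \<subseteq> W" using W open_contains_cball by blast
  obtain b :: "'e \<Rightarrow> real" where b: "smooth_on b UNIV" "\<And>x. dist (\<phi> p) x \<le> e / 2 \<Longrightarrow> b x = 1"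
    "\<And>x. dist (\<phi> p) x \<ge> 2 * (e / 2) \<Longrightarrow> b x = 0"
    using smooth_bump[of "e / 2" "\<phi> p"] half_gt_zero[OF e(1)] by blast
  define f where "f q = (if q \<in> U \<and> \<phi> q \<in> W then b (\<phi> q) * h (\<phi> q) else 0)" for q
  let ?K = "inv_into U \<phi> ` cball (\<phi> p) e"
  have "compactin (top_of_set (\<phi> ` U)) (cball (\<phi> p) e)"
    using e W(3) by (simp add: compactin_subtopology)
  from image_compactin[OF this continuous_map_inv_chart[OF U]]
  have K: "closedin (atlas_topology A) ?K" using Hausdorff compactin_imp_closedin by blast
  have out: "f q = 0" if "q \<notin> ?K" for q
  proof (cases "q \<in> U \<and> \<phi> q \<in> W")
    case True
    then have "\<phi> q \<notin> cball (\<phi> p) e" using that inv_chart[OF U, of q] by force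
    then show ?thesis using b(3)[of "\<phi> q"] by (simp add: f_def)
  qed (auto simp: f_def)
  show thesis
  proof
    show "f \<in> smooth_functions A"
    proof (rule smooth_functionsI)
      show "f q = 0" if "q \<notin> points A" for q
        using that chart_subset_points[OF U] by (auto simp: f_def)
      fix q assume q: "q \<in> points A"
      show "\<exists>U \<phi> X. (U, \<phi>) \<in> A \<and> openin (atlas_topology A) X \<and>
        q \<in> U \<inter> X \<and> smooth_on (f \<circ> inv_into U \<phi>) (\<phi> ` (U \<inter> X))"
      proof (cases "q \<in> ?K")
        case True
        let ?X = "{x \<in> U. \<phi> x \<in> W}"
        have X: "openin (atlas_topology A) ?X" by (rule openin_chart_preimage[OF U W(1)])
        have q: "q \<in> ?X"
          using True e W(3) by (auto simp: f_inv_into_f inv_into_into subset_iff)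
        have im: "\<phi> ` (U \<inter> ?X) = W" using W(3) by auto
        have "smooth_on (\<lambda>x. b x * h x) W"
          using W(1) h smooth_on_subset[OF b(1)] by (intro smooth_on_mult) auto
        then have "smooth_on (f \<circ> inv_into U \<phi>) W"
          by (rule smooth_on_cong[OF W(1), rotated])
            (use W(3) in \<open>auto simp: f_def f_inv_into_f inv_into_into subset_iff\<close>)
        then have "smooth_on (f \<circ> inv_into U \<phi>) (\<phi> ` (U \<inter> ?X))" unfolding im .
        with U X q show ?thesis by blast
      next
        case False
        obtain V \<psi> where V: "(V, \<psi>) \<in> A" "q \<in> V" using q point_in_chart by blast
        have X: "openin (atlas_topology A) (points A - ?K)"
          using K topspace_atlas by (metis openin_diff openin_topspace)
        have "smooth_on (f \<circ> inv_into V \<psi>) (\<psi> ` (V \<inter> (points A - ?K)))"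
          by (rule smooth_on_cong[OF _ _ smooth_on_const[of _ 0]])
            (use open_image_chart[OF X V(1)] in \<open>auto simp: inv_chart[OF V(1)] out\<close>)
        then show ?thesis using V X q False by blast
      qed
    qed
    show "f q = h (\<phi> q)" if "q \<in> U" "\<phi> q \<in> ball (\<phi> p) (e / 2)" for q
      using that e b(2)[of "\<phi> q"] by (auto simp: f_def subset_iff)
    show "ball (\<phi> p) (e / 2) \<subseteq> W" using e by (auto simp: subset_iff)
  qed (use e in \<open>auto simp: f_def\<close>)
qed

end

section \<open>Tangent vectors\<close>

context smooth_atlas
begin

lemma tangent_add:
  "v \<in> tangent_space A p \<Longrightarrow> f \<in> smooth_functions A \<Longrightarrow> g \<in> smooth_functions A \<Longrightarrow> v (f + g) = v f + v g"
  unfolding tangent_space_def by blast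

lemma tangent_scale:
  "v \<in> tangent_space A p \<Longrightarrow> f \<in> smooth_functions A \<Longrightarrow> v (\<lambda>x. c * f x) = c * v f"
  unfolding tangent_space_def by blast

lemma tangent_mult:
  "v \<in> tangent_space A p \<Longrightarrow> f \<in> smooth_functions A \<Longrightarrow> g \<in> smooth_functions A \<Longrightarrow>
    v (f * g) = v f * g p + f p * v g"
  unfolding tangent_space_def by blast

lemma tangent_undefined: "v \<in> tangent_space A p \<Longrightarrow> f \<notin> smooth_functions A \<Longrightarrow> v f = 0"
  unfolding tangent_space_def by blast

lemma tangent_0: "v \<in> tangent_space A p \<Longrightarrow> v 0 = 0"
  using tangent_scale[of v p 0 0] smooth_functions_0 by (simp add: zero_fun_def)

lemma tangent_minus: "v \<in> tangent_space A p \<Longrightarrow> f \<in> smooth_functions A \<Longrightarrow> v (- f) = - v f"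
  using tangent_scale[of v p f "-1"] by (simp add: fun_Compl_def)

lemma tangent_sum:
  assumes "v \<in> tangent_space A p" "\<And>i. i \<in> I \<Longrightarrow> f i \<in> smooth_functions A"
  shows "v (\<Sum>i\<in>I. f i) = (\<Sum>i\<in>I. v (f i))"
  using assms(2)
  by (induction I rule: infinite_finite_induct)
    (auto simp: tangent_0[OF assms(1)] tangent_add[OF assms(1)] smooth_functions_sum)

lemma tangent_space_zero: "(\<lambda>f. 0) \<in> tangent_space A p"
  unfolding tangent_space_def by simp

lemma tangent_space_add:
  "v \<in> tangent_space A p \<Longrightarrow> w \<in> tangent_space A p \<Longrightarrow> (\<lambda>f. v f + w f) \<in> tangent_space A p"
  unfolding tangent_space_def by (auto simp: algebra_simps)

lemma tangent_space_scale:
  "v \<in> tangent_space A p \<Longrightarrow> (\<lambda>f. c * v f) \<in> tangent_space A p"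
  unfolding tangent_space_def by (auto simp: algebra_simps)

lemma tangent_space_sum:
  "(\<And>i. i \<in> I \<Longrightarrow> v i \<in> tangent_space A p) \<Longrightarrow> (\<lambda>f. \<Sum>i\<in>I. v i f) \<in> tangent_space A p"
  by (induction I rule: infinite_finite_induct) (auto intro: tangent_space_zero tangent_space_add)

end

text \<open>The inverse of \<open>tangent_components\<close> in a chart. The value 0 off the smooth
  functions is the normal form that \<open>tangent_space\<close> demands, so that equal tangent
  vectors are equal as functions.\<close>

definition coordinate_vector ::
    "('a, 'e::euclidean_space) chart set \<Rightarrow> ('a, 'e) chart \<Rightarrow> 'a \<Rightarrow> 'e \<Rightarrow> 'a tangent_vector" where
  "coordinate_vector A c p w f =
     (if f \<in> smooth_functions A
      then frechet_derivative (f \<circ> inv_into (fst c) (snd c)) (at (snd c p)) w else 0)"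

context smooth_atlas
begin

context
  fixes U \<phi> p
  assumes U: "(U, \<phi>) \<in> A" and p: "p \<in> U"
begin

lemma chart_has_derivative:
  "f \<in> smooth_functions A \<Longrightarrow>
    (f \<circ> inv_into U \<phi> has_derivative (\<lambda>w. coordinate_vector A (U, \<phi>) p w f)) (at (\<phi> p))"
  using smooth_on_has_derivative[OF smooth_functions_chart[OF _ U]] p
  by (simp add: coordinate_vector_def)

lemma coordinate_vector_eqI:
  assumes "f \<in> smooth_functions A" "(f \<circ> inv_into U \<phi> has_derivative D) (at (\<phi> p))"
  shows "coordinate_vector A (U, \<phi>) p w f = D w"
  using frechet_derivative_at[OF assms(2)] assms(1) by (simp add: coordinate_vector_def)

lemma bounded_linear_coordinate_vector:
  "bounded_linear (\<lambda>w. coordinate_vector A (U, \<phi>) p w f)"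
proof (cases "f \<in> smooth_functions A")
  case True
  then show ?thesis using has_derivative_bounded_linear[OF chart_has_derivative] by blast
qed (simp add: coordinate_vector_def[abs_def] bounded_linear_zero)

lemma coordinate_vector_tangent: "coordinate_vector A (U, \<phi>) p w \<in> tangent_space A p"
proof -
  let ?v = "coordinate_vector A (U, \<phi>) p"
  have "?v w (f + g) = ?v w f + ?v w g"
    if "f \<in> smooth_functions A" "g \<in> smooth_functions A" for f g
    unfolding plus_comp using that
    by (intro coordinate_vector_eqI smooth_functions_add)
      (auto simp only: plus_comp intro!: has_derivative_add chart_has_derivative)
  moreover have "?v w (\<lambda>x. c * f x) = c * ?v w f" if "f \<in> smooth_functions A" for c f
  proof (rule coordinate_vector_eqI)
    have "(\<lambda>x. c * f x) \<circ> inv_into U \<phi> = (\<lambda>x. c * (f \<circ> inv_into U \<phi>) x)" by auto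
    then show "((\<lambda>x. c * f x) \<circ> inv_into U \<phi> has_derivative (\<lambda>w. c * ?v w f)) (at (\<phi> p))"
      using has_derivative_mult_right[OF chart_has_derivative[OF that], of c] by simp
  qed (simp add: smooth_functions_scale that)
  moreover have "?v w (f * g) = ?v w f * g p + f p * ?v w g"
    if "f \<in> smooth_functions A" "g \<in> smooth_functions A" for f g
  proof -
    have "(f * g \<circ> inv_into U \<phi> has_derivative (\<lambda>w. (f \<circ> inv_into U \<phi>) (\<phi> p) * ?v w g +
        ?v w f * (g \<circ> inv_into U \<phi>) (\<phi> p))) (at (\<phi> p))"
      unfolding times_comp by (intro has_derivative_mult chart_has_derivative that)
    from coordinate_vector_eqI[OF smooth_functions_mult[OF that] this]
    show ?thesis by (simp add: inv_chart[OF U p])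
  qed
  ultimately show ?thesis
    unfolding tangent_space_def by (auto simp: coordinate_vector_def)
qed

end

end

context smooth_manifold
begin

text \<open>A cutoff \<open>b\<close> that lives in \<open>X\<close> and is 1 at \<open>p\<close>
  gives (f - g) b = 0. The Leibniz rule at \<open>p\<close>, where f - g vanishes, then leaves v (f
  - g) = 0.\<close>

lemma tangent_local:
  assumes v: "v \<in> tangent_space A p" and f: "f \<in> smooth_functions A" and g: "g \<in> smooth_functions A"
    and X: "openin (atlas_topology A) X" "p \<in> X" and eq: "\<And>q. q \<in> X \<Longrightarrow> f q = g q"
  shows "v f = v g"
proof -
  obtain U \<phi> where U: "(U, \<phi>) \<in> A" "p \<in> U"
    using X point_in_chart openin_subset topspace_atlas by blast
  have o: "open (\<phi> ` (U \<inter> X))" by (rule open_image_chart[OF X(1) U(1)])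
  obtain b N where b: "b \<in> smooth_functions A" "open N" "\<phi> p \<in> N" "N \<subseteq> \<phi> ` (U \<inter> X)"
    "\<And>q. q \<in> U \<Longrightarrow> \<phi> q \<in> N \<Longrightarrow> b q = 1" "\<And>q. \<not> (q \<in> U \<and> \<phi> q \<in> \<phi> ` (U \<inter> X)) \<Longrightarrow> b q = 0"
    by (rule smooth_extension[OF U o _ _ smooth_on_const[OF o, of "1 :: real"]]) (use U X in auto)
  let ?h = "f + - g"
  have h: "?h \<in> smooth_functions A" by (intro smooth_functions_add smooth_functions_minus f g)
  have "b q = 0" if "q \<notin> X" for q
    using b(6)[of q] inj_chart[OF U(1)] that by (auto simp: inj_on_def)
  then have "?h * b = 0" using eq by (auto simp: fun_eq_iff)
  then have "v (?h * b) = 0" using tangent_0[OF v] by simp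
  then have "v ?h * b p + ?h p * v b = 0" using tangent_mult[OF v h b(1)] by simp
  then have "v ?h = 0" using b(5)[OF U(2) b(3)] eq[OF X(2)] by simp
  then show ?thesis
    using tangent_add[OF v f smooth_functions_minus[OF g]] tangent_minus[OF v g] by simp
qed

context
  fixes U \<phi> p
  assumes U: "(U, \<phi>) \<in> A" and p: "p \<in> U"
begin

text \<open>Near \<open>p\<close>, Hadamard's lemma writes \<open>f\<close> as its value at
  \<open>p\<close> plus a sum of products of functions \<open>y i\<close> vanishing at
  \<open>p\<close> with coefficients \<open>G i\<close>. The Leibniz rule leaves
  \<open>v (y i)\<close> times a partial derivative of \<open>f\<close>, so \<open>v\<close> is
  known from the numbers \<open>v (y i)\<close>. Each ingredient is cut off because \<open>v\<close>
  sees only global smooth functions.\<close>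

lemma tangent_coordinates_exist:
  assumes v: "v \<in> tangent_space A p"
  shows "\<exists>w. v = coordinate_vector A (U, \<phi>) p w"
proof -
  let ?a = "\<phi> p"
  have o: "open (\<phi> ` U)" "?a \<in> \<phi> ` U" using open_chart_image[OF U] p by auto
  have "\<exists>y N. y \<in> smooth_functions A \<and> open N \<and> ?a \<in> N \<and>
      (\<forall>q\<in>U. \<phi> q \<in> N \<longrightarrow> y q = (\<phi> q - ?a) \<bullet> i)" for i
  proof -
    have "smooth_on (\<lambda>x. (x - ?a) \<bullet> i) (\<phi> ` U)"
      using o(1) by (intro smooth_on_bilinear[OF bounded_bilinear_inner] smooth_on_diff smooth_on_id smooth_on_const)
    from smooth_extension[OF U p o subset_refl this] show ?thesis by metis
  qed
  then obtain y N where y: "\<And>i. y i \<in> smooth_functions A" "\<And>i. open (N i)" "\<And>i. ?a \<in> N i"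
      "\<And>i q. q \<in> U \<Longrightarrow> \<phi> q \<in> N i \<Longrightarrow> y i q = (\<phi> q - ?a) \<bullet> i"
    by metis
  define w where "w = (\<Sum>i\<in>Basis. v (y i) *\<^sub>R i)"
  have "v f = coordinate_vector A (U, \<phi>) p w f" for f
  proof (cases "f \<in> smooth_functions A")
    case f: True
    obtain r where r: "r > 0" "ball ?a r \<subseteq> \<phi> ` U" using openE[OF o] .
    let ?W = "ball ?a r"
    have W: "?a \<in> ?W" using r(1) by simp
    have sf: "smooth_on (f \<circ> inv_into U \<phi>) ?W"
      by (rule smooth_on_subset[OF smooth_functions_chart[OF f U] r(2)])
    obtain g where g: "\<And>i. smooth_on (g i) ?W"
        "\<And>i. g i ?a = frechet_derivative (f \<circ> inv_into U \<phi>) (at ?a) i"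
        "\<And>x. x \<in> ?W \<Longrightarrow> (f \<circ> inv_into U \<phi>) x =
          (f \<circ> inv_into U \<phi>) ?a + (\<Sum>i\<in>Basis. ((x - ?a) \<bullet> i) * g i x)"
      using Hadamard_lemma[OF open_ball convex_ball W sf] by blast
    have "\<exists>G M. G \<in> smooth_functions A \<and> open M \<and> ?a \<in> M \<and> (\<forall>q\<in>U. \<phi> q \<in> M \<longrightarrow> G q = g i (\<phi> q))" for i
      using smooth_extension[OF U p open_ball W r(2) g(1)[of i]] by metis
    then obtain G M where G: "\<And>i. G i \<in> smooth_functions A" "\<And>i. open (M i)" "\<And>i. ?a \<in> M i"
        "\<And>i q. q \<in> U \<Longrightarrow> \<phi> q \<in> M i \<Longrightarrow> G i q = g i (\<phi> q)"
      by metis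
    obtain b L where b: "b \<in> smooth_functions A" "open L" "?a \<in> L" "\<And>q. q \<in> U \<Longrightarrow> \<phi> q \<in> L \<Longrightarrow> b q = 1"
      using smooth_extension[OF U p o subset_refl smooth_on_const[OF o(1), of "1 :: real"]] by metis
    have bb: "b * b \<in> smooth_functions A" by (intro smooth_functions_mult b)
    have "v (b * b) = v b"
      by (rule tangent_local[OF v bb b(1) openin_chart_preimage[OF U b(2)]]) (use p b(3,4) in auto)
    \<comment> \<open>Near \<open>p\<close> the cutoff satisfies b b = b, and
      \<open>b p = 1\<close>, so the Leibniz rule reads v b = 2 v b. Here \<open>b\<close> replaces
      the constant 1 in the expansion of \<open>f\<close>.\<close>
    then have vb: "v b = 0" using tangent_mult[OF v b(1) b(1)] b(3,4) p by simp
    let ?S = "\<Sum>i\<in>Basis. y i * G i"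
    let ?F = "(\<lambda>x. f p * b x) + ?S"
    have yG: "y i * G i \<in> smooth_functions A" for i by (intro smooth_functions_mult y G)
    have S: "?S \<in> smooth_functions A" by (intro smooth_functions_sum yG)
    \<comment> \<open>A neighbourhood on which all the cut-off functions agree with their local
      models; it is open because \<open>Basis\<close> is finite.\<close>
    let ?Z = "?W \<inter> L \<inter> (\<Inter>i\<in>Basis. N i \<inter> M i)"
    have Z: "open ?Z" using b y G by (intro open_Int open_INT) auto
    have "v f = v ?F"
    proof (rule tangent_local[OF v f _ openin_chart_preimage[OF U Z]])
      show "?F \<in> smooth_functions A" by (intro smooth_functions_add smooth_functions_scale b S)
      show "p \<in> {x \<in> U. \<phi> x \<in> ?Z}" using p W b y G by auto
      fix q assume q: "q \<in> {x \<in> U. \<phi> x \<in> ?Z}"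
      have sum_app: "(\<Sum>i\<in>I. h i) q = (\<Sum>i\<in>I. h i q)" for I :: "'e set" and h :: "'e \<Rightarrow> 'a \<Rightarrow> real"
        by (induction I rule: infinite_finite_induct) auto
      have "f q = f p + (\<Sum>i\<in>Basis. ((\<phi> q - ?a) \<bullet> i) * g i (\<phi> q))"
        using g(3)[of "\<phi> q"] q inv_chart[OF U] p by auto
      also have "\<dots> = ?F q"
        using q b(4)[of q] y(4)[of q] G(4)[of q] by (auto simp: sum_app intro!: sum.cong)
      finally show "f q = ?F q" .
    qed
    also have "\<dots> = v ?S"
      using tangent_add[OF v smooth_functions_scale[OF b(1)] S] tangent_scale[OF v b(1)] vb by simp
    also have "\<dots> = (\<Sum>i\<in>Basis. v (y i * G i))" by (rule tangent_sum[OF v yG])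
    also have "\<dots> = (\<Sum>i\<in>Basis. v (y i) * coordinate_vector A (U, \<phi>) p i f)"
    proof (intro sum.cong refl)
      fix i
      show "v (y i * G i) = v (y i) * coordinate_vector A (U, \<phi>) p i f"
        using tangent_mult[OF v y(1) G(1)] y(4)[OF p y(3), of i] G(4)[OF p G(3), of i] g(2)[of i] f
        by (simp add: coordinate_vector_def)
    qed
    also have "\<dots> = coordinate_vector A (U, \<phi>) p w f"
      using derivative_basis_expansion[OF bounded_linear_coordinate_vector[OF U p], of w f]
      by (simp add: w_def)
    finally show ?thesis .
  next
    case False
    then show ?thesis using tangent_undefined[OF v] by (simp add: coordinate_vector_def)
  qed
  then show ?thesis by blast
qed

text \<open>Applied to a cut-off coordinate function, a coordinate vector returns the corresponding
  component of \<open>w\<close>.\<close>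

lemma coordinate_vector_inj:
  assumes "coordinate_vector A (U, \<phi>) p w = coordinate_vector A (U, \<phi>) p w'"
  shows "w = w'"
proof (rule euclidean_eqI)
  fix i :: 'e
  have o: "open (\<phi> ` U)" "\<phi> p \<in> \<phi> ` U" using open_chart_image[OF U] p by auto
  have "smooth_on (\<lambda>x. x \<bullet> i) (\<phi> ` U)"
    using o(1) by (intro smooth_on_bounded_linear bounded_linear_inner_left)
  then obtain y N where y: "y \<in> smooth_functions A" "open N" "\<phi> p \<in> N" "N \<subseteq> \<phi> ` U"
      "\<And>q. q \<in> U \<Longrightarrow> \<phi> q \<in> N \<Longrightarrow> y q = \<phi> q \<bullet> i"
    using smooth_extension[OF U p o subset_refl] by metis
  have "((\<lambda>x. x \<bullet> i) has_derivative (\<lambda>u. u \<bullet> i)) (at (\<phi> p))"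
    by (auto intro!: derivative_eq_intros)
  then have "(y \<circ> inv_into U \<phi> has_derivative (\<lambda>u. u \<bullet> i)) (at (\<phi> p))"
    by (rule has_derivative_transform_within_open[OF _ y(2,3)])
      (use y(4,5) in \<open>auto simp: f_inv_into_f inv_into_into subset_iff\<close>)
  from coordinate_vector_eqI[OF U p y(1) this]
  show "w \<bullet> i = w' \<bullet> i" using assms by metis
qed

lemma tangent_components_coordinate_vector:
  "tangent_components A (U, \<phi>) p (coordinate_vector A (U, \<phi>) p w) = w"
  unfolding tangent_components_def
proof (rule the_equality)
  fix w' assume "\<forall>f\<in>smooth_functions A. coordinate_vector A (U, \<phi>) p w f =
      frechet_derivative (f \<circ> inv_into (fst (U, \<phi>)) (snd (U, \<phi>))) (at (snd (U, \<phi>) p)) w'"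
  then have "coordinate_vector A (U, \<phi>) p w' = coordinate_vector A (U, \<phi>) p w"
    by (auto simp: coordinate_vector_def)
  then show "w' = w" by (rule coordinate_vector_inj)
qed (simp add: coordinate_vector_def)

end

end

section \<open>The tangent bundle as a manifold\<close>

context smooth_manifold
begin

definition tangent_dom :: "'a set \<Rightarrow> ('a \<times> 'a tangent_vector) set" where
  "tangent_dom U = {z \<in> tangent_bundle A. fst z \<in> U}"

definition tangent_coords :: "'a set \<Rightarrow> ('a \<Rightarrow> 'e) \<Rightarrow> 'a \<times> 'a tangent_vector \<Rightarrow> 'e \<times> 'e" where
  "tangent_coords U \<phi> z = (\<phi> (fst z), tangent_components A (U, \<phi>) (fst z) (snd z))"

lemma tangent_atlas_iff:
  "(X, \<Phi>) \<in> tangent_atlas A \<longleftrightarrow>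
    (\<exists>U \<phi>. (U, \<phi>) \<in> A \<and> X = tangent_dom U \<and> \<Phi> = tangent_coords U \<phi>)"
  unfolding tangent_atlas_def tangent_chart_def tangent_dom_def tangent_coords_def[abs_def]
  by (force simp: image_iff)

lemma tangent_atlasI: "(U, \<phi>) \<in> A \<Longrightarrow> (tangent_dom U, tangent_coords U \<phi>) \<in> tangent_atlas A"
  using tangent_atlas_iff by blast

context
  fixes U \<phi>
  assumes U: "(U, \<phi>) \<in> A"
begin

lemma coordinate_vector_in_tangent_dom:
  "p \<in> U \<Longrightarrow> (p, coordinate_vector A (U, \<phi>) p w) \<in> tangent_dom U"
  using chart_subset_points[OF U] coordinate_vector_tangent[OF U]
  by (auto simp: tangent_dom_def tangent_bundle_def)

lemma coordinate_vector_in_tangent_bundle: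
  "p \<in> U \<Longrightarrow> (p, coordinate_vector A (U, \<phi>) p w) \<in> tangent_bundle A"
  using coordinate_vector_in_tangent_dom by (auto simp: tangent_dom_def)

lemma tangent_coords_coordinate_vector:
  "p \<in> U \<Longrightarrow> tangent_coords U \<phi> (p, coordinate_vector A (U, \<phi>) p w) = (\<phi> p, w)"
  using tangent_components_coordinate_vector[OF U] by (simp add: tangent_coords_def)

lemma tangent_dom_cases:
  assumes "z \<in> tangent_dom U"
  obtains p w where "p \<in> U" "z = (p, coordinate_vector A (U, \<phi>) p w)"
proof (cases z)
  case (Pair p v)
  then have "p \<in> U" "v \<in> tangent_space A p"
    using assms by (auto simp: tangent_dom_def tangent_bundle_def)
  then show ?thesis using that tangent_coordinates_exist[OF U] Pair by blast
qed

lemma inj_tangent_coords: "inj_on (tangent_coords U \<phi>) (tangent_dom U)"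
proof (rule inj_onI)
  fix z z' assume "z \<in> tangent_dom U" "z' \<in> tangent_dom U" and eq: "tangent_coords U \<phi> z = tangent_coords U \<phi> z'"
  then obtain p w p' w' where z: "p \<in> U" "z = (p, coordinate_vector A (U, \<phi>) p w)"
      "p' \<in> U" "z' = (p', coordinate_vector A (U, \<phi>) p' w')"
    using tangent_dom_cases by metis
  then have "\<phi> p = \<phi> p'" "w = w'" using eq by (auto simp: tangent_coords_coordinate_vector)
  then show "z = z'" using z inj_chart[OF U] by (auto simp: inj_on_def)
qed

lemma inv_tangent_coords:
  assumes "x \<in> \<phi> ` U"
  shows "inv_into (tangent_dom U) (tangent_coords U \<phi>) (x, w) =
    (inv_into U \<phi> x, coordinate_vector A (U, \<phi>) (inv_into U \<phi> x) w)"
  using assms inv_into_f_eq[OF inj_tangent_coords coordinate_vector_in_tangent_dom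
      tangent_coords_coordinate_vector]
  by (auto simp: inv_chart[OF U])

lemma tangent_coords_image:
  "tangent_coords U \<phi> ` (tangent_dom U \<inter> {z \<in> tangent_bundle A. fst z \<in> X}) = \<phi> ` (U \<inter> X) \<times> UNIV"
proof (intro set_eqI iffI)
  fix y assume "y \<in> tangent_coords U \<phi> ` (tangent_dom U \<inter> {z \<in> tangent_bundle A. fst z \<in> X})"
  then show "y \<in> \<phi> ` (U \<inter> X) \<times> UNIV" by (auto simp: tangent_coords_def tangent_dom_def)
next
  fix y assume "y \<in> \<phi> ` (U \<inter> X) \<times> (UNIV :: 'e set)"
  then obtain p w where p: "p \<in> U" "p \<in> X" "y = (\<phi> p, w)" by auto
  have "(p, coordinate_vector A (U, \<phi>) p w) \<in> tangent_dom U \<inter> {z \<in> tangent_bundle A. fst z \<in> X}"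
    using coordinate_vector_in_tangent_dom[OF p(1), of w] p(2) by (simp add: tangent_dom_def)
  moreover have "y = tangent_coords U \<phi> (p, coordinate_vector A (U, \<phi>) p w)"
    using tangent_coords_coordinate_vector[OF p(1)] p(3) by simp
  ultimately show "y \<in> tangent_coords U \<phi> ` (tangent_dom U \<inter> {z \<in> tangent_bundle A. fst z \<in> X})"
    by (rule rev_image_eqI)
qed

lemma tangent_coords_image_dom: "tangent_coords U \<phi> ` tangent_dom U = \<phi> ` U \<times> UNIV"
proof -
  have "tangent_dom U = tangent_dom U \<inter> {z \<in> tangent_bundle A. fst z \<in> U}"
    by (auto simp: tangent_dom_def)
  then show ?thesis using tangent_coords_image[of U] by simp
qed

end

text \<open>The chain rule: components of a fixed tangent vector change by the derivative of the
  transition map.\<close>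

lemma coordinate_vector_transition:
  assumes U: "(U, \<phi>) \<in> A" and V: "(V, \<psi>) \<in> A" and p: "p \<in> U" "p \<in> V"
  shows "coordinate_vector A (U, \<phi>) p w =
    coordinate_vector A (V, \<psi>) p (frechet_derivative (\<psi> \<circ> inv_into U \<phi>) (at (\<phi> p)) w)"
proof
  fix f
  show "coordinate_vector A (U, \<phi>) p w f =
    coordinate_vector A (V, \<psi>) p (frechet_derivative (\<psi> \<circ> inv_into U \<phi>) (at (\<phi> p)) w) f"
  proof (cases "f \<in> smooth_functions A")
    case f: True
    let ?T = "\<psi> \<circ> inv_into U \<phi>"
    have T: "(?T has_derivative frechet_derivative ?T (at (\<phi> p))) (at (\<phi> p))"
      using smooth_on_has_derivative[OF smooth_transition[OF U V]] p by blast
    have "?T (\<phi> p) = \<psi> p" by (simp add: inv_chart[OF U p(1)])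
    then have "((\<lambda>x. (f \<circ> inv_into V \<psi>) (?T x)) has_derivative
        (\<lambda>w. coordinate_vector A (V, \<psi>) p (frechet_derivative ?T (at (\<phi> p)) w) f)) (at (\<phi> p))"
      using has_derivative_compose[OF T, of "f \<circ> inv_into V \<psi>"] chart_has_derivative[OF V p(2) f] by simp
    then have "(f \<circ> inv_into U \<phi> has_derivative
        (\<lambda>w. coordinate_vector A (V, \<psi>) p (frechet_derivative ?T (at (\<phi> p)) w) f)) (at (\<phi> p))"
      by (rule has_derivative_transform_within_open[OF _ open_overlap[OF U V]])
        (use p in \<open>auto simp: inv_chart[OF U] inv_chart[OF V]\<close>)
    from coordinate_vector_eqI[OF U p(1) f this] show ?thesis .
  qed (simp add: coordinate_vector_def)
qed

lemma tangent_dom_Int: "tangent_dom U \<inter> tangent_dom V = tangent_dom U \<inter> {z \<in> tangent_bundle A. fst z \<in> V}"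
  by (auto simp: tangent_dom_def)

lemma smooth_atlas_tangent: "smooth_atlas (tangent_atlas A)"
proof
  fix X \<Phi> assume "(X, \<Phi>) \<in> tangent_atlas A"
  then show "inj_on \<Phi> X" by (auto simp: tangent_atlas_iff inj_tangent_coords)
next
  fix X \<Phi> Y \<Psi> assume XY: "(X, \<Phi>) \<in> tangent_atlas A" "(Y, \<Psi>) \<in> tangent_atlas A"
  obtain U \<phi> where U: "(U, \<phi>) \<in> A" "X = tangent_dom U" "\<Phi> = tangent_coords U \<phi>"
    using XY(1) by (auto simp: tangent_atlas_iff)
  obtain V \<psi> where V: "(V, \<psi>) \<in> A" "Y = tangent_dom V" "\<Psi> = tangent_coords V \<psi>"
    using XY(2) by (auto simp: tangent_atlas_iff)
  have im: "\<Phi> ` (X \<inter> Y) = \<phi> ` (U \<inter> V) \<times> UNIV"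
    unfolding U V tangent_dom_Int by (rule tangent_coords_image[OF U(1)])
  show o: "open (\<Phi> ` (X \<inter> Y))"
    unfolding im by (intro open_Times open_overlap[OF U(1) V(1)] open_UNIV)
  let ?T = "\<psi> \<circ> inv_into U \<phi>"
  have T: "smooth_on ?T (\<phi> ` (U \<inter> V))" by (rule smooth_transition[OF U(1) V(1)])
  show "smooth_on (\<Psi> \<circ> inv_into X \<Phi>) (\<Phi> ` (X \<inter> Y))"
  proof (rule smooth_on_cong[OF o])
    \<comment> \<open>The transition between induced charts is the tangent map of the transition
      \<open>?T\<close> on P: the base point moves by \<open>?T\<close>, the vector by its
      derivative.\<close>
    show "smooth_on (\<lambda>z. (?T (fst z), frechet_derivative ?T (at (fst z)) (snd z))) (\<Phi> ` (X \<inter> Y))"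
    proof (rule smooth_on_Pair[OF o])
      show "smooth_on (\<lambda>z. ?T (fst z)) (\<Phi> ` (X \<inter> Y))"
        by (rule smooth_on_compose[OF o open_overlap[OF U(1) V(1)] smooth_on_bounded_linear[OF bounded_linear_fst o] _ T])
          (auto simp: im)
      show "smooth_on (\<lambda>z. frechet_derivative ?T (at (fst z)) (snd z)) (\<Phi> ` (X \<inter> Y))"
        unfolding im by (rule smooth_on_differential[OF open_overlap[OF U(1) V(1)] T])
    qed
    fix z assume "z \<in> \<Phi> ` (X \<inter> Y)"
    then obtain p w where p: "p \<in> U" "p \<in> V" and z: "z = (\<phi> p, w)" by (auto simp: im)
    have "inv_into X \<Phi> z = (p, coordinate_vector A (U, \<phi>) p w)"
      using inv_tangent_coords[OF U(1), of "\<phi> p" w] p by (simp add: U z inv_chart[OF U(1)])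
    then show "(?T (fst z), frechet_derivative ?T (at (fst z)) (snd z)) = (\<Psi> \<circ> inv_into X \<Phi>) z"
      using coordinate_vector_transition[OF U(1) V(1) p, of w] tangent_coords_coordinate_vector[OF V(1) p(2)]
      by (simp add: V z inv_chart[OF U(1) p(1)])
  qed
qed

interpretation T: smooth_atlas "tangent_atlas A" by (rule smooth_atlas_tangent)

lemma points_tangent_atlas: "points (tangent_atlas A) = tangent_bundle A"
proof -
  have "z \<in> points (tangent_atlas A)" if z: "z \<in> tangent_bundle A" for z
  proof -
    have "fst z \<in> points A" using z by (auto simp: tangent_bundle_def)
    then obtain U \<phi> where "(U, \<phi>) \<in> A" "fst z \<in> U" by (rule point_in_chart)
    then show ?thesis
      using T.chart_subset_points[OF tangent_atlasI] z by (fastforce simp: tangent_dom_def)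
  qed
  moreover have "points (tangent_atlas A) \<subseteq> tangent_bundle A"
    by (auto simp: points_def tangent_atlas_def tangent_chart_def)
  ultimately show ?thesis by blast
qed

section \<open>The topology of the tangent bundle\<close>

lemma openin_tangent_preimage:
  assumes "openin (atlas_topology A) X"
  shows "openin (atlas_topology (tangent_atlas A)) {z \<in> tangent_bundle A. fst z \<in> X}"
  unfolding T.openin_atlas_iff points_tangent_atlas
proof (intro conjI ballI)
  fix c assume "c \<in> tangent_atlas A"
  then obtain U \<phi> where "(U, \<phi>) \<in> A" "c = (tangent_dom U, tangent_coords U \<phi>)"
    using tangent_atlas_iff by (metis surj_pair)
  then show "case c of (W, \<Phi>) \<Rightarrow> open (\<Phi> ` (W \<inter> {z \<in> tangent_bundle A. fst z \<in> X}))"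
    by (simp add: tangent_coords_image open_Times open_image_chart[OF assms])
qed auto

text \<open>Two vectors in one fibre lie in a common chart and are separated there by their
  coordinates. Vectors over different points are separated by the preimages of disjoint open sets of
  the base.\<close>

lemma Hausdorff_tangent: "Hausdorff_space (atlas_topology (tangent_atlas A))"
  unfolding Hausdorff_space_def T.topspace_atlas points_tangent_atlas
proof (intro allI impI)
  fix y z assume yz: "y \<in> tangent_bundle A \<and> z \<in> tangent_bundle A \<and> y \<noteq> z"
  then have pts: "fst y \<in> points A" "fst z \<in> points A" by (auto simp: tangent_bundle_def)
  let ?D = "\<exists>U V. openin (atlas_topology (tangent_atlas A)) U \<and> openin (atlas_topology (tangent_atlas A)) V \<and>
    y \<in> U \<and> z \<in> V \<and> disjnt U V"
  show ?D
  proof (cases "fst y = fst z")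
    case True
    obtain U \<phi> where U: "(U, \<phi>) \<in> A" "fst y \<in> U" using point_in_chart[OF pts(1)] .
    have dom: "y \<in> tangent_dom U" "z \<in> tangent_dom U" using yz U(2) True by (auto simp: tangent_dom_def)
    let ?c = "tangent_coords U \<phi>"
    have "?c y \<noteq> ?c z" using inj_on_eq_iff[OF inj_tangent_coords[OF U(1)] dom] yz by simp
    then obtain S S' where S: "open S" "open S'" "?c y \<in> S" "?c z \<in> S'" "S \<inter> S' = {}"
      by (metis hausdorff)
    show ?D
      by (intro exI[of _ "{x \<in> tangent_dom U. ?c x \<in> S}"] exI[of _ "{x \<in> tangent_dom U. ?c x \<in> S'}"] conjI
          T.openin_chart_preimage[OF tangent_atlasI[OF U(1)]])
        (use S dom in \<open>auto simp: disjnt_def\<close>)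
  next
    case False
    then obtain X Y where X: "openin (atlas_topology A) X" "openin (atlas_topology A) Y"
        "fst y \<in> X" "fst z \<in> Y" "disjnt X Y"
      using Hausdorff pts unfolding Hausdorff_space_def topspace_atlas by blast
    show ?D
      by (intro exI[of _ "{x \<in> tangent_bundle A. fst x \<in> X}"] exI[of _ "{x \<in> tangent_bundle A. fst x \<in> Y}"]
          conjI openin_tangent_preimage X)
        (use X yz in \<open>auto simp: disjnt_def\<close>)
  qed
qed

text \<open>The given atlas may be uncountable. A second countable space is Lindelof, so countably
  many chart domains already cover it.\<close>

lemma countable_subatlas:
  obtains C where "C \<subseteq> A" "countable C" "points C = points A"
proof -
  have "Lindelof_space (atlas_topology A)"
    using second_countable second_countable_imp_Lindelof_space by blast
  moreover have "openin (atlas_topology A) X" if "X \<in> fst ` A" for X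
    using that openin_chart by auto
  moreover have "topspace (atlas_topology A) = \<Union> (fst ` A)" by (simp add: topspace_atlas points_def)
  ultimately obtain V where V: "countable V" "V \<subseteq> fst ` A" "\<Union> V = points A"
    unfolding Lindelof_space_def using topspace_atlas by metis
  obtain C where "C \<subseteq> A" "countable C" "V = fst ` C"
    using V(1,2) countable_subset_image[of V fst A] by blast
  then show thesis using that V(3) by (simp add: points_def)
qed

text \<open>The base consists of the preimages of a countable base of \<open>'e \<times> 'e\<close>
  under the charts induced by a countable subatlas.\<close>

lemma second_countable_tangent: "second_countable (atlas_topology (tangent_atlas A))"
proof -
  obtain C where C: "C \<subseteq> A" "countable C" "points C = points A" by (rule countable_subatlas)
  obtain B :: "('e \<times> 'e) set set" where B: "countable B" "\<And>S. S \<in> B \<Longrightarrow> open S"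
      "\<And>S. open S \<Longrightarrow> \<exists>K\<subseteq>B. S = \<Union> K"
    using ex_countable_basis unfolding topological_basis_def by (metis)
  define base where "base = (\<lambda>((U, \<phi>), S). {z \<in> tangent_dom U. tangent_coords U \<phi> z \<in> S}) ` (C \<times> B)"
  have "countable base" unfolding base_def using C(2) B(1) by (intro countable_image countable_SIGMA) auto
  moreover have "openin (atlas_topology (tangent_atlas A)) X" if "X \<in> base" for X
    using that C(1) B(2) unfolding base_def
    by (auto intro!: T.openin_chart_preimage[OF tangent_atlasI])
  moreover have "\<exists>Y\<in>base. z \<in> Y \<and> Y \<subseteq> X"
    if X: "openin (atlas_topology (tangent_atlas A)) X" "z \<in> X" for X z
  proof -
    have z: "z \<in> tangent_bundle A"
      using openin_subset[OF X(1)] X(2) unfolding T.topspace_atlas points_tangent_atlas by blast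
    then have "fst z \<in> points C" unfolding C(3) tangent_bundle_def by auto
    then obtain c where "c \<in> C" "fst z \<in> fst c" unfolding points_def by blast
    then obtain U \<phi> where U: "(U, \<phi>) \<in> C" "fst z \<in> U" by (cases c) simp
    then have UA: "(U, \<phi>) \<in> A" using C(1) by blast
    have dom: "z \<in> tangent_dom U" using z U by (simp add: tangent_dom_def)
    have "open (tangent_coords U \<phi> ` (tangent_dom U \<inter> X))"
      by (rule T.open_image_chart[OF X(1) tangent_atlasI[OF UA]])
    from B(3)[OF this] obtain K where K: "K \<subseteq> B" "tangent_coords U \<phi> ` (tangent_dom U \<inter> X) = \<Union> K"
      by (elim exE conjE)
    have "tangent_coords U \<phi> z \<in> \<Union> K" unfolding K(2)[symmetric] using dom X(2) by blast
    then obtain S where S: "S \<in> B" "tangent_coords U \<phi> z \<in> S" "S \<subseteq> tangent_coords U \<phi> ` (tangent_dom U \<inter> X)"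
      unfolding K(2) using K(1) by blast
    have "{y \<in> tangent_dom U. tangent_coords U \<phi> y \<in> S} \<in> base"
      unfolding base_def using U(1) S(1) by (intro image_eqI[of _ _ "((U, \<phi>), S)"]) auto
    moreover have "{y \<in> tangent_dom U. tangent_coords U \<phi> y \<in> S} \<subseteq> X"
      using S(3) inj_tangent_coords[OF UA] by (auto simp: inj_on_def)
    ultimately show ?thesis using dom S(2) by (intro bexI[of _ "{y \<in> tangent_dom U. tangent_coords U \<phi> y \<in> S}"]) auto
  qed
  ultimately show ?thesis unfolding second_countable_def by (intro exI[of _ base]) auto
qed

lemma smooth_manifold_tangent: "smooth_manifold (tangent_atlas A)"
  using smooth_manifold_iff smooth_atlas_tangent Hausdorff_tangent second_countable_tangent by blast

interpretation T: smooth_manifold "tangent_atlas A" by (rule smooth_manifold_tangent)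

section \<open>The functions \<open>f \<circ> \<tau>\<close> and \<open>df\<close> in induced
  charts\<close>

abbreviation TA where "TA \<equiv> tangent_atlas A"

context
  fixes U \<phi>
  assumes U: "(U, \<phi>) \<in> A"
begin

lemma tangent_pullback_chart:
  "z \<in> \<phi> ` U \<times> UNIV \<Longrightarrow> tangent_pullback A f (inv_into (tangent_dom U) (tangent_coords U \<phi>) z) =
    f (inv_into U \<phi> (fst z))"
  by (auto simp: inv_tangent_coords[OF U] inv_chart[OF U] coordinate_vector_in_tangent_bundle[OF U]
      tangent_pullback_def zero_ext_def)

lemma form_function_chart:
  "f \<in> smooth_functions A \<Longrightarrow> z \<in> \<phi> ` U \<times> UNIV \<Longrightarrow>
    form_function A (differential f) (inv_into (tangent_dom U) (tangent_coords U \<phi>) z) =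
    frechet_derivative (f \<circ> inv_into U \<phi>) (at (fst z)) (snd z)"
  by (auto simp: inv_tangent_coords[OF U] inv_chart[OF U] coordinate_vector_in_tangent_bundle[OF U]
      form_function_def zero_ext_def differential_def coordinate_vector_def)

lemma open_tangent_chart_image: "open (\<phi> ` U \<times> (UNIV :: 'e set))"
  by (intro open_Times open_chart_image[OF U] open_UNIV)

end

lemma tangent_pullback_smooth:
  assumes f: "f \<in> smooth_functions A"
  shows "tangent_pullback A f \<in> smooth_functions TA"
  unfolding smooth_functions_def
proof (intro CollectI conjI allI impI ballI)
  show "tangent_pullback A f z = 0" if "z \<notin> points TA" for z
    using that by (simp add: points_tangent_atlas tangent_pullback_def zero_ext_def)
  fix c assume "c \<in> TA"
  then obtain U \<phi> where U: "(U, \<phi>) \<in> A" "c = (tangent_dom U, tangent_coords U \<phi>)"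
    using tangent_atlas_iff by (metis surj_pair)
  note o = open_tangent_chart_image[OF U(1)]
  have "smooth_on (\<lambda>z. (f \<circ> inv_into U \<phi>) (fst z)) (\<phi> ` U \<times> (UNIV :: 'e set))"
    by (rule smooth_on_compose[OF o open_chart_image[OF U(1)] smooth_on_bounded_linear[OF bounded_linear_fst o] _
        smooth_functions_chart[OF f U(1)]]) auto
  then have "smooth_on (tangent_pullback A f \<circ> inv_into (tangent_dom U) (tangent_coords U \<phi>)) (\<phi> ` U \<times> UNIV)"
    by (rule smooth_on_cong[OF o, rotated]) (simp add: tangent_pullback_chart[OF U(1)])
  then show "case c of (W, \<Phi>) \<Rightarrow> smooth_on (tangent_pullback A f \<circ> inv_into W \<Phi>) (\<Phi> ` W)"
    by (simp add: U(2) tangent_coords_image_dom[OF U(1)])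
qed

lemma form_function_smooth:
  assumes f: "f \<in> smooth_functions A"
  shows "form_function A (differential f) \<in> smooth_functions TA"
  unfolding smooth_functions_def
proof (intro CollectI conjI allI impI ballI)
  show "form_function A (differential f) z = 0" if "z \<notin> points TA" for z
    using that by (simp add: points_tangent_atlas form_function_def zero_ext_def)
  fix c assume "c \<in> TA"
  then obtain U \<phi> where U: "(U, \<phi>) \<in> A" "c = (tangent_dom U, tangent_coords U \<phi>)"
    using tangent_atlas_iff by (metis surj_pair)
  have "smooth_on (form_function A (differential f) \<circ> inv_into (tangent_dom U) (tangent_coords U \<phi>)) (\<phi> ` U \<times> UNIV)"
    by (rule smooth_on_cong[OF open_tangent_chart_image[OF U(1)] _
          smooth_on_differential[OF open_chart_image[OF U(1)] smooth_functions_chart[OF f U(1)]]])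
      (simp add: form_function_chart[OF U(1) f])
  then show "case c of (W, \<Phi>) \<Rightarrow> smooth_on (form_function A (differential f) \<circ> inv_into W \<Phi>) (\<Phi> ` W)"
    by (simp add: U(2) tangent_coords_image_dom[OF U(1)])
qed

context
  fixes U \<phi> p and w :: 'e
  assumes U: "(U, \<phi>) \<in> A" and p: "p \<in> U"
begin

abbreviation "tangent_point \<equiv> (p, coordinate_vector A (U, \<phi>) p w)"
abbreviation "lifted_vector \<equiv> coordinate_vector TA (tangent_dom U, tangent_coords U \<phi>) tangent_point"

lemma lifted_vector_pullback:
  assumes f: "f \<in> smooth_functions A"
  shows "lifted_vector (a, b) (tangent_pullback A f) = coordinate_vector A (U, \<phi>) p a f"
proof -
  have "((\<lambda>z. (f \<circ> inv_into U \<phi>) (fst z)) has_derivative (\<lambda>u. coordinate_vector A (U, \<phi>) p (fst u) f)) (at (\<phi> p, w))"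
    using has_derivative_compose[OF has_derivative_fst[OF has_derivative_ident], of "f \<circ> inv_into U \<phi>" _ "(\<phi> p, w)" UNIV]
      chart_has_derivative[OF U p f] by simp
  then have "(tangent_pullback A f \<circ> inv_into (tangent_dom U) (tangent_coords U \<phi>) has_derivative
      (\<lambda>u. coordinate_vector A (U, \<phi>) p (fst u) f)) (at (\<phi> p, w))"
    by (rule has_derivative_transform_within_open[OF _ open_tangent_chart_image[OF U]])
      (use p tangent_pullback_chart[OF U] in auto)
  from T.coordinate_vector_eqI[OF tangent_atlasI[OF U] coordinate_vector_in_tangent_dom[OF U p]
      tangent_pullback_smooth[OF f], unfolded tangent_coords_coordinate_vector[OF U p], OF this]
  show ?thesis by simp
qed

text \<open>This differentiates (x, w) to Df(x) w along \<open>(a, b)\<close>. The second-order term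
  is written as the derivative along \<open>w\<close> of the derivative in direction
  \<open>a\<close>, because that is how the product rule produces it in
  \<open>bracket_derivative\<close>.\<close>

lemma lifted_vector_form:
  assumes f: "f \<in> smooth_functions A"
  shows "lifted_vector (a, b) (form_function A (differential f)) =
    frechet_derivative (\<lambda>x. frechet_derivative (f \<circ> inv_into U \<phi>) (at x) a) (at (\<phi> p)) w +
    coordinate_vector A (U, \<phi>) p b f"
proof -
  let ?f = "f \<circ> inv_into U \<phi>"
  let ?d = "\<lambda>i x. frechet_derivative ?f (at x) i"
  have sf: "smooth_on ?f (\<phi> ` U)" by (rule smooth_functions_chart[OF f U])
  have sd: "smooth_on (?d i) (\<phi> ` U)" for i by (rule smooth_on_derivative[OF sf])
  have pU: "\<phi> p \<in> \<phi> ` U" using p by simp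
  let ?dd = "\<lambda>i. frechet_derivative (?d i) (at (\<phi> p))"
  have bl: "bounded_linear (?dd i)" for i
    by (rule has_derivative_bounded_linear[OF smooth_on_has_derivative[OF sd pU]])
  have d: "((\<lambda>z. ?d i (fst z)) has_derivative (\<lambda>u. ?dd i (fst u))) (at (\<phi> p, w))" for i
    using has_derivative_compose[OF has_derivative_fst[OF has_derivative_ident], of "?d i" "?dd i" "(\<phi> p, w)" UNIV]
      smooth_on_has_derivative[OF sd pU] by simp
  have "((\<lambda>z. \<Sum>i\<in>Basis. (snd z \<bullet> i) * ?d i (fst z)) has_derivative
      (\<lambda>u. \<Sum>i\<in>Basis. (w \<bullet> i) * ?dd i (fst u) + (snd u \<bullet> i) * ?d i (\<phi> p))) (at (\<phi> p, w))"
    by (auto intro!: derivative_eq_intros d)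
  then have "(form_function A (differential f) \<circ> inv_into (tangent_dom U) (tangent_coords U \<phi>) has_derivative
      (\<lambda>u. \<Sum>i\<in>Basis. (w \<bullet> i) * ?dd i (fst u) + (snd u \<bullet> i) * ?d i (\<phi> p))) (at (\<phi> p, w))"
  proof (rule has_derivative_transform_within_open[OF _ open_tangent_chart_image[OF U]])
    fix z assume z: "z \<in> \<phi> ` U \<times> (UNIV :: 'e set)"
    then have "(?f has_derivative frechet_derivative ?f (at (fst z))) (at (fst z))"
      using smooth_on_has_derivative[OF sf] by auto
    from derivative_basis_expansion[OF has_derivative_bounded_linear[OF this], of "snd z"]
    show "(\<Sum>i\<in>Basis. (snd z \<bullet> i) * ?d i (fst z)) =
        (form_function A (differential f) \<circ> inv_into (tangent_dom U) (tangent_coords U \<phi>)) z"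
      using form_function_chart[OF U f z] by simp
  qed (use p in auto)
  from T.coordinate_vector_eqI[OF tangent_atlasI[OF U] coordinate_vector_in_tangent_dom[OF U p]
      form_function_smooth[OF f], unfolded tangent_coords_coordinate_vector[OF U p], OF this, of "(a, b)"]
  have "lifted_vector (a, b) (form_function A (differential f)) =
      (\<Sum>i\<in>Basis. (w \<bullet> i) * ?dd i a) + (\<Sum>i\<in>Basis. (b \<bullet> i) * ?d i (\<phi> p))"
    by (simp add: sum.distrib)
  \<comment> \<open>Symmetry of second derivatives exchanges the direction of differentiation
    \<open>a\<close> with the basis vector coming from the expansion of \<open>w\<close>.\<close>
  also have "(\<Sum>i\<in>Basis. (w \<bullet> i) * ?dd i a) = (\<Sum>i\<in>Basis. (w \<bullet> i) * ?dd a i)"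
    by (intro sum.cong refl arg_cong2[where f = times] second_derivative_symmetric[OF open_chart_image[OF U] sf pU])
  also have "\<dots> = ?dd a w" using derivative_basis_expansion[OF bl[of a], of w] by simp
  also have "(\<Sum>i\<in>Basis. (b \<bullet> i) * ?d i (\<phi> p)) = coordinate_vector A (U, \<phi>) p b f"
    using derivative_basis_expansion[OF bounded_linear_coordinate_vector[OF U p], of b f] f
    by (simp add: coordinate_vector_def)
  finally show ?thesis .
qed

end

lemma tangent_lift_separation:
  assumes V: "V \<in> tangent_space TA z" and z: "z \<in> tangent_bundle A"
    and gen: "\<And>f. f \<in> smooth_functions A \<Longrightarrow> V (tangent_pullback A f) = 0"
      "\<And>f. f \<in> smooth_functions A \<Longrightarrow> V (form_function A (differential f)) = 0"
  shows "V = (\<lambda>F. 0)"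
proof -
  have "fst z \<in> points A" using z by (auto simp: tangent_bundle_def)
  then obtain U \<phi> where U: "(U, \<phi>) \<in> A" "fst z \<in> U" by (rule point_in_chart)
  have dom: "z \<in> tangent_dom U" using z U by (simp add: tangent_dom_def)
  then obtain p w where p: "p \<in> U" and z: "z = (p, coordinate_vector A (U, \<phi>) p w)"
    using tangent_dom_cases[OF U(1)] by blast
  let ?v = "coordinate_vector TA (tangent_dom U, tangent_coords U \<phi>) z"
  obtain a b where V': "V = ?v (a, b)"
    using T.tangent_coordinates_exist[OF tangent_atlasI[OF U(1)] dom V] by auto
  note bl = bounded_linear_coordinate_vector[OF U(1) p]
  have zero: "coordinate_vector A (U, \<phi>) p 0 f = 0" for f
    using linear_0[OF bounded_linear.linear[OF bl]] .
  have "coordinate_vector A (U, \<phi>) p a f = coordinate_vector A (U, \<phi>) p 0 f" for f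
  proof (cases "f \<in> smooth_functions A")
    case True
    then show ?thesis using gen(1)[OF True] lifted_vector_pullback[OF U(1) p True, of w a b] zero
      by (simp add: V' z)
  qed (simp add: coordinate_vector_def)
  then have a: "a = 0" using coordinate_vector_inj[OF U(1) p] by blast
  \<comment> \<open>With \<open>a = 0\<close> the second-order term drops out of the derivative of
    \<open>df\<close>, and only now can \<open>b\<close> be read off from it.\<close>
  have "coordinate_vector A (U, \<phi>) p b f = coordinate_vector A (U, \<phi>) p 0 f" for f
  proof (cases "f \<in> smooth_functions A")
    case True
    have sf: "smooth_on (f \<circ> inv_into U \<phi>) (\<phi> ` U)" by (rule smooth_functions_chart[OF True U(1)])
    have "frechet_derivative (f \<circ> inv_into U \<phi>) (at x) 0 = 0" if "x \<in> \<phi> ` U" for x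
      using linear_0[OF has_derivative_linear[OF smooth_on_has_derivative[OF sf that]]] .
    then have "frechet_derivative (\<lambda>x. frechet_derivative (f \<circ> inv_into U \<phi>) (at x) 0) (at (\<phi> p)) =
        frechet_derivative (\<lambda>x. 0) (at (\<phi> p))"
      using open_chart_image[OF U(1)] p by (intro frechet_derivative_cong[of "\<phi> ` U"]) auto
    then show ?thesis using gen(2)[OF True] lifted_vector_form[OF U(1) p True, of w a b] zero
      by (simp add: V' z a frechet_derivative_const)
  qed (simp add: coordinate_vector_def)
  then have b: "b = 0" using coordinate_vector_inj[OF U(1) p] by blast
  have "?v 0 F = 0" for F
    using linear_0[OF bounded_linear.linear[OF T.bounded_linear_coordinate_vector[OF tangent_atlasI[OF U(1)] dom]]] .
  then show ?thesis using V' a b by (auto simp: zero_prod_def)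
qed

end

section \<open>Biderivations and the Jacobiator\<close>

text \<open>A Poisson structure apart from the Jacobi identity. The lift is shown to be one of these
  first, so that the derivation property of the Jacobiator is available for proving that
  identity.\<close>

locale almost_poisson_manifold = smooth_manifold A
  for A :: "('a, 'e::euclidean_space) chart set" +
  fixes bracket :: "('a \<Rightarrow> real) \<Rightarrow> ('a \<Rightarrow> real) \<Rightarrow> 'a \<Rightarrow> real"
  assumes smooth_bracket:
      "f \<in> smooth_functions A \<Longrightarrow> g \<in> smooth_functions A \<Longrightarrow> bracket f g \<in> smooth_functions A"
    and undefined_bracket:
      "f \<notin> smooth_functions A \<or> g \<notin> smooth_functions A \<Longrightarrow> bracket f g = 0"
    and add_bracket:
      "f \<in> smooth_functions A \<Longrightarrow> g \<in> smooth_functions A \<Longrightarrow> h \<in> smooth_functions A \<Longrightarrow>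
       bracket (f + g) h = bracket f h + bracket g h"
    and scale_bracket:
      "f \<in> smooth_functions A \<Longrightarrow> g \<in> smooth_functions A \<Longrightarrow>
       bracket (\<lambda>x. c * f x) g = (\<lambda>x. c * bracket f g x)"
    and antisym_bracket:
      "f \<in> smooth_functions A \<Longrightarrow> g \<in> smooth_functions A \<Longrightarrow> bracket f g = - bracket g f"
    and Leibniz_bracket:
      "f \<in> smooth_functions A \<Longrightarrow> g \<in> smooth_functions A \<Longrightarrow> h \<in> smooth_functions A \<Longrightarrow>
       bracket f (g * h) = bracket f g * h + g * bracket f h"
begin

abbreviation "sf \<equiv> smooth_functions A"

lemma add_bracket_right:
  assumes "f \<in> sf" "g \<in> sf" "h \<in> sf"
  shows "bracket h (f + g) = bracket h f + bracket h g"
  using add_bracket[OF assms] antisym_bracket[of h] assms by (simp add: smooth_functions_add)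

lemma scale_bracket_right:
  assumes "f \<in> sf" "g \<in> sf"
  shows "bracket g (\<lambda>x. c * f x) = (\<lambda>x. c * bracket g f x)"
  using scale_bracket[OF assms, of c] antisym_bracket[of g] assms
  by (simp add: smooth_functions_scale fun_Compl_def)

lemma Leibniz_bracket_left:
  assumes "f \<in> sf" "g \<in> sf" "h \<in> sf"
  shows "bracket (f * g) h = bracket f h * g + f * bracket g h"
  using Leibniz_bracket[OF assms(3,1,2)] antisym_bracket[of _ h] assms
  by (simp add: smooth_functions_mult algebra_simps)

lemma zero_bracket_right: "bracket f 0 = 0"
  using scale_bracket_right[OF smooth_functions_0, of f 0] undefined_bracket[of f 0]
  by (cases "f \<in> sf") (auto simp: zero_fun_def)

text \<open>The convention that the bracket is zero on non-smooth arguments matches the one in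
  \<open>tangent_space\<close>; hence every \<open>g\<close> and every \<open>p\<close> is allowed,
  and later arguments need no side conditions.\<close>

lemma bracket_tangent: "(\<lambda>f. bracket f g p) \<in> tangent_space A p"
proof (cases "g \<in> sf")
  case True
  then show ?thesis
    unfolding tangent_space_def
    by (auto simp: add_bracket scale_bracket Leibniz_bracket_left undefined_bracket)
next
  case False
  then show ?thesis using undefined_bracket tangent_space_zero by simp
qed

lemma bracket_tangent_right: "(\<lambda>g. bracket f g p) \<in> tangent_space A p"
proof (cases "f \<in> sf")
  case True
  then show ?thesis
    unfolding tangent_space_def
    by (auto simp: add_bracket_right scale_bracket_right Leibniz_bracket undefined_bracket)
next
  case False
  then show ?thesis using undefined_bracket tangent_space_zero by simp
qed

definition jacobiator :: "('a \<Rightarrow> real) \<Rightarrow> ('a \<Rightarrow> real) \<Rightarrow> ('a \<Rightarrow> real) \<Rightarrow> 'a \<Rightarrow> real" where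
  "jacobiator f g h = bracket f (bracket g h) + bracket g (bracket h f) + bracket h (bracket f g)"

lemma jacobiator_cyclic: "jacobiator f g h = jacobiator g h f"
  by (simp add: jacobiator_def algebra_simps)

text \<open>In its first argument the Jacobiator is a commutator of derivations minus a derivation,
  hence itself a derivation.\<close>

lemma jacobiator_commutator:
  assumes "f \<in> sf" "g \<in> sf" "h \<in> sf"
  shows "jacobiator f g h =
    bracket f (bracket g h) + (bracket g (bracket h f) - bracket h (bracket g f))"
proof -
  have "bracket h (bracket f g) = - bracket h (bracket g f)"
    using antisym_bracket[OF assms(1,2)] scale_bracket_right[OF smooth_bracket[OF assms(2,1)] assms(3), of "-1"]
    by (simp add: fun_Compl_def)
  then show ?thesis by (simp add: jacobiator_def)
qed

lemma jacobiator_tangent: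
  assumes g: "g \<in> sf" and h: "h \<in> sf"
  shows "(\<lambda>f. jacobiator f g h p) \<in> tangent_space A p"
proof -
  note closed = g h smooth_bracket smooth_functions_add smooth_functions_scale smooth_functions_mult
  have "jacobiator (f + f') g h = jacobiator f g h + jacobiator f' g h" if "f \<in> sf" "f' \<in> sf" for f f'
    using that by (simp add: jacobiator_def add_bracket add_bracket_right closed algebra_simps)
  moreover have "jacobiator (\<lambda>x. c * f x) g h = (\<lambda>x. c * jacobiator f g h x)" if "f \<in> sf" for c f
    using that
    by (simp add: jacobiator_def scale_bracket scale_bracket_right closed fun_eq_iff algebra_simps)
  moreover have "jacobiator (f * f') g h = jacobiator f g h * f' + f * jacobiator f' g h"
    if f: "f \<in> sf" "f' \<in> sf" for f f'
  proof -
    \<comment> \<open>The two cross terms are symmetric in \<open>a\<close> and \<open>b\<close>, so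
      they cancel in the commutator of the derivations by \<open>g\<close> and
      \<open>h\<close>.\<close>
    have "bracket a (bracket b (f * f')) = bracket a (bracket b f) * f' + bracket b f * bracket a f' +
        bracket a f * bracket b f' + f * bracket a (bracket b f')" if "a \<in> sf" "b \<in> sf" for a b
      using that f by (simp add: Leibniz_bracket add_bracket_right closed algebra_simps)
    then show ?thesis
      using f by (simp add: jacobiator_commutator closed Leibniz_bracket_left algebra_simps)
  qed
  moreover have "jacobiator f g h = 0" if "f \<notin> sf" for f
    using that by (simp add: jacobiator_def undefined_bracket zero_bracket_right)
  ultimately show ?thesis unfolding tangent_space_def by auto
qed

end

lemma (in almost_poisson_manifold) poisson_manifoldI:
  assumes "\<And>f g h. f \<in> sf \<Longrightarrow> g \<in> sf \<Longrightarrow> h \<in> sf \<Longrightarrow> jacobiator f g h = 0"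
  shows "poisson_manifold A bracket"
  by unfold_locales
    (fact smooth_bracket undefined_bracket add_bracket scale_bracket antisym_bracket Leibniz_bracket
      assms[unfolded jacobiator_def])+

sublocale poisson_manifold \<subseteq> almost_poisson_manifold
  by unfold_locales
    (fact bracket_smooth bracket_undefined bracket_add bracket_scale bracket_antisym bracket_Leibniz)+

section \<open>The bivector in a chart\<close>

context smooth_manifold
begin

text \<open>Cut-off coordinates whose differentials are dual to the basis on a whole neighbourhood
  and not only at \<open>p\<close>; this uniformity is what later yields smooth components of the
  bivector.\<close>

lemma coordinate_functions:
  assumes U: "(U, \<phi>) \<in> A" and p: "p \<in> U"
  shows "\<exists>y N. (\<forall>i. y i \<in> smooth_functions A) \<and> open N \<and> \<phi> p \<in> N \<and> N \<subseteq> \<phi> ` U \<and>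
    (\<forall>i\<in>Basis. \<forall>q\<in>U. \<phi> q \<in> N \<longrightarrow> (\<forall>w. coordinate_vector A (U, \<phi>) q w (y i) = w \<bullet> i))"
proof -
  have o: "open (\<phi> ` U)" "\<phi> p \<in> \<phi> ` U" using open_chart_image[OF U] p by auto
  have "\<exists>y N. y \<in> smooth_functions A \<and> open N \<and> \<phi> p \<in> N \<and> N \<subseteq> \<phi> ` U \<and>
      (\<forall>q\<in>U. \<phi> q \<in> N \<longrightarrow> y q = \<phi> q \<bullet> i)" for i
  proof -
    have "smooth_on (\<lambda>x. x \<bullet> i) (\<phi> ` U)"
      using o(1) by (intro smooth_on_bounded_linear bounded_linear_inner_left)
    from smooth_extension[OF U p o subset_refl this] show ?thesis by metis
  qed
  then obtain y N where y: "\<And>i. y i \<in> smooth_functions A" "\<And>i. open (N i)" "\<And>i. \<phi> p \<in> N i"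
      "\<And>i. N i \<subseteq> \<phi> ` U" "\<And>i q. q \<in> U \<Longrightarrow> \<phi> q \<in> N i \<Longrightarrow> y i q = \<phi> q \<bullet> i"
    by metis
  have "coordinate_vector A (U, \<phi>) q w (y i) = w \<bullet> i" if q: "q \<in> U" "\<phi> q \<in> N i" for i q w
  proof -
    have "((\<lambda>x. x \<bullet> i) has_derivative (\<lambda>u. u \<bullet> i)) (at (\<phi> q))"
      by (auto intro!: derivative_eq_intros)
    then have "(y i \<circ> inv_into U \<phi> has_derivative (\<lambda>u. u \<bullet> i)) (at (\<phi> q))"
      by (rule has_derivative_transform_within_open[OF _ y(2)[of i] q(2)])
        (use y(4)[of i] y(5)[of _ i] in \<open>auto simp: f_inv_into_f inv_into_into subset_iff\<close>)
    from coordinate_vector_eqI[OF U q(1) y(1) this] show ?thesis .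
  qed
  moreover have "open (\<phi> ` U \<inter> (\<Inter>i\<in>Basis. N i))" using o y(2) by (intro open_Int open_INT) auto
  ultimately show ?thesis
    using y(1,3) o(2) by (intro exI[of _ y] exI[of _ "\<phi> ` U \<inter> (\<Inter>i\<in>Basis. N i)"]) auto
qed

end

context almost_poisson_manifold
begin

text \<open>Each slot is a tangent vector at \<open>q\<close>, and a tangent vector is determined by
  its values on the \<open>y i\<close>. Expanding one slot and then the other gives the matrix of
  the bivector.\<close>

lemma bracket_in_coordinates:
  assumes U: "(U, \<phi>) \<in> A" and q: "q \<in> U"
    and y: "\<And>i w. i \<in> Basis \<Longrightarrow> coordinate_vector A (U, \<phi>) q w (y i) = w \<bullet> i"
  shows "bracket f g q = (\<Sum>i\<in>Basis. \<Sum>j\<in>Basis. bracket (y i) (y j) q *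
    (coordinate_vector A (U, \<phi>) q i f * coordinate_vector A (U, \<phi>) q j g))"
proof -
  let ?v = "coordinate_vector A (U, \<phi>) q"
  have expand: "v f = (\<Sum>i\<in>Basis. v (y i) * ?v i f)" if v: "v \<in> tangent_space A q" for v f
  proof -
    obtain w where w: "v = ?v w" using tangent_coordinates_exist[OF U q v] by blast
    show ?thesis
      using derivative_basis_expansion[OF bounded_linear_coordinate_vector[OF U q], of w f] y
      by (simp add: w)
  qed
  have "bracket f g q = (\<Sum>i\<in>Basis. bracket (y i) g q * ?v i f)"
    using expand[OF bracket_tangent] .
  also have "\<dots> = (\<Sum>i\<in>Basis. (\<Sum>j\<in>Basis. bracket (y i) (y j) q * ?v j g) * ?v i f)"
    using expand[OF bracket_tangent_right, of _ g] by simp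
  finally show ?thesis by (simp add: sum_distrib_left mult_ac)
qed

lemma bivector_exists:
  assumes U: "(U, \<phi>) \<in> A"
  shows "\<exists>\<Lambda>. (\<forall>i\<in>Basis. \<forall>j\<in>Basis. smooth_on (\<Lambda> i j) (\<phi> ` U)) \<and>
    (\<forall>p\<in>U. \<forall>f g. bracket f g p = (\<Sum>i\<in>Basis. \<Sum>j\<in>Basis. \<Lambda> i j (\<phi> p) *
      (coordinate_vector A (U, \<phi>) p i f * coordinate_vector A (U, \<phi>) p j g)))"
proof -
  have "\<forall>p\<in>U. \<exists>y N. (\<forall>i. y i \<in> smooth_functions A) \<and> open N \<and> \<phi> p \<in> N \<and> N \<subseteq> \<phi> ` U \<and>
    (\<forall>i\<in>Basis. \<forall>q\<in>U. \<phi> q \<in> N \<longrightarrow> (\<forall>w. coordinate_vector A (U, \<phi>) q w (y i) = w \<bullet> i))"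
    using coordinate_functions[OF U] by blast
  then obtain Y N where Y: "\<And>p i. p \<in> U \<Longrightarrow> Y p i \<in> smooth_functions A"
      "\<And>p. p \<in> U \<Longrightarrow> open (N p) \<and> \<phi> p \<in> N p \<and> N p \<subseteq> \<phi> ` U"
      "\<And>p i q w. p \<in> U \<Longrightarrow> i \<in> Basis \<Longrightarrow> q \<in> U \<Longrightarrow> \<phi> q \<in> N p \<Longrightarrow>
        coordinate_vector A (U, \<phi>) q w (Y p i) = w \<bullet> i"
    by metis
  \<comment> \<open>At each point the bracket is taken of the cut-off coordinates chosen for that
    very point, so smoothness in \<open>x\<close> is not evident from the definition.\<close>
  define \<Lambda> where "\<Lambda> i j x = bracket (Y (inv_into U \<phi> x) i) (Y (inv_into U \<phi> x) j) (inv_into U \<phi> x)" for i j x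
  have \<Lambda>: "bracket f g p = (\<Sum>i\<in>Basis. \<Sum>j\<in>Basis. \<Lambda> i j (\<phi> p) *
      (coordinate_vector A (U, \<phi>) p i f * coordinate_vector A (U, \<phi>) p j g))" if p: "p \<in> U" for f g p
  proof -
    have "\<Lambda> i j (\<phi> p) = bracket (Y p i) (Y p j) p" for i j
      unfolding \<Lambda>_def inv_chart[OF U p] ..
    then show ?thesis
      using bracket_in_coordinates[OF U p Y(3)[OF p _ p], of f g] Y(2)[OF p] by simp
  qed
  have "smooth_on (\<Lambda> i j) (\<phi> ` U)" if ij: "i \<in> Basis" "j \<in> Basis" for i j
  proof (rule smooth_on_local)
    fix x assume "x \<in> \<phi> ` U"
    then obtain p where p: "p \<in> U" "x = \<phi> p" by blast
    note N = Y(2)[OF p(1)]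
    \<comment> \<open>The functions chosen at \<open>p\<close> still have dual differentials at
      nearby \<open>q\<close>. The coordinate formula at \<open>q\<close>, applied to them, returns
      \<open>\<Lambda> i j (\<phi> q)\<close>, so near \<open>p\<close> the component is the bracket
      of two fixed smooth functions.\<close>
    have "bracket (Y p i) (Y p j) q = \<Lambda> i j (\<phi> q)" if q: "q \<in> U" "\<phi> q \<in> N p" for q
    proof -
      have "bracket (Y p i) (Y p j) q =
          (\<Sum>k\<in>Basis. \<Sum>l\<in>Basis. \<Lambda> k l (\<phi> q) * ((k \<bullet> i) * (l \<bullet> j)))"
        using \<Lambda>[OF q(1), of "Y p i" "Y p j"] Y(3)[OF p(1) ij(1) q] Y(3)[OF p(1) ij(2) q] by simp
      also have "\<dots> = (\<Sum>k\<in>Basis. if k = i then \<Lambda> k j (\<phi> q) else 0)"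
      proof (rule sum.cong[OF refl])
        fix k :: 'e assume k: "k \<in> Basis"
        have "(\<Sum>l\<in>Basis. \<Lambda> k l (\<phi> q) * ((k \<bullet> i) * (l \<bullet> j))) =
            (\<Sum>l\<in>Basis. if l = j then \<Lambda> k l (\<phi> q) * (k \<bullet> i) else 0)"
          by (rule sum.cong[OF refl]) (use ij in \<open>auto simp: inner_Basis\<close>)
        then show "(\<Sum>l\<in>Basis. \<Lambda> k l (\<phi> q) * ((k \<bullet> i) * (l \<bullet> j))) = (if k = i then \<Lambda> k j (\<phi> q) else 0)"
          using ij k by (simp add: inner_Basis)
      qed
      also have "\<dots> = \<Lambda> i j (\<phi> q)" using ij by simp
      finally show ?thesis .
    qed
    moreover have "smooth_on (bracket (Y p i) (Y p j) \<circ> inv_into U \<phi>) (N p)"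
      using smooth_on_subset[OF smooth_functions_chart[OF smooth_bracket[OF Y(1) Y(1)] U]] p N by blast
    ultimately have "smooth_on (\<Lambda> i j) (N p)"
      using N by (elim smooth_on_cong[rotated 2]) (auto simp: inv_into_into f_inv_into_f subset_iff)
    then show "\<exists>N. open N \<and> x \<in> N \<and> smooth_on (\<Lambda> i j) N" using N p by blast
  qed
  with \<Lambda> show ?thesis by blast
qed

end

section \<open>The tangent lift\<close>

context poisson_manifold
begin

interpretation T: smooth_manifold "tangent_atlas A" by (rule smooth_manifold_tangent)

section \<open>The lift at a single tangent vector\<close>

abbreviation "form f \<equiv> form_function A (differential f)"
abbreviation "pullback f \<equiv> tangent_pullback A f"

text \<open>A description of the lift at one point in which no chart occurs. Both mixed orders are
  prescribed because antisymmetry is not part of the description; it is derived afterwards from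
  uniqueness.\<close>

definition tangent_lift_at ::
    "'a \<times> 'a tangent_vector \<Rightarrow> (('a \<times> 'a tangent_vector \<Rightarrow> real) \<Rightarrow> ('a \<times> 'a tangent_vector \<Rightarrow> real) \<Rightarrow> real) \<Rightarrow> bool"
  where
  "tangent_lift_at z b \<longleftrightarrow>
    (\<forall>G. (\<lambda>F. b F G) \<in> tangent_space TA z) \<and> (\<forall>F. (\<lambda>G. b F G) \<in> tangent_space TA z) \<and>
    (\<forall>f\<in>sf. \<forall>g\<in>sf. b (form f) (form g) = form (bracket f g) z \<and> b (pullback f) (pullback g) = 0 \<and>
      b (form f) (pullback g) = pullback (bracket f g) z \<and> b (pullback f) (form g) = pullback (bracket f g) z)"

lemma tangent_lift_at_unique:
  assumes z: "z \<in> tangent_bundle A" and b: "tangent_lift_at z b" and b': "tangent_lift_at z b'"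
  shows "b = b'"
proof -
  let ?d = "\<lambda>F G. b F G + (-1) * b' F G"
  have d1: "(\<lambda>F. ?d F G) \<in> tangent_space TA z" for G
    using b b' unfolding tangent_lift_at_def by (intro T.tangent_space_add T.tangent_space_scale) auto
  have d2: "(\<lambda>G. ?d F G) \<in> tangent_space TA z" for F
    using b b' unfolding tangent_lift_at_def by (intro T.tangent_space_add T.tangent_space_scale) auto
  \<comment> \<open>The first slot is freed while the second holds a generator; this supplies the
    input for freeing the second slot.\<close>
  have gen: "?d F (pullback g) = 0 \<and> ?d F (form g) = 0" if g: "g \<in> sf" for F g
  proof
    show "?d F (pullback g) = 0"
      by (rule fun_cong[OF tangent_lift_separation[OF d1 z]])
        (use b b' g in \<open>auto simp: tangent_lift_at_def\<close>)
    show "?d F (form g) = 0"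
      by (rule fun_cong[OF tangent_lift_separation[OF d1 z]])
        (use b b' g in \<open>auto simp: tangent_lift_at_def\<close>)
  qed
  have "?d F G = 0" for F G
    by (rule fun_cong[OF tangent_lift_separation[OF d2 z]]) (use gen in blast)+
  then show ?thesis by (auto simp: fun_eq_iff)
qed

lemma tangent_space_mult_left: "V \<in> tangent_space TA z \<Longrightarrow> (\<lambda>F. V F * c) \<in> tangent_space TA z"
  using T.tangent_space_scale[of V z c] by (simp add: mult.commute)

section \<open>The lift in a chart\<close>

text \<open>The complete lift of the bivector. In induced coordinates \<open>v (0, i)\<close> is the
  derivative in the fibre direction \<open>i\<close> and \<open>v (i, 0)\<close> the derivative in
  the base direction \<open>i\<close>.\<close>

definition chart_lift where
  "chart_lift U \<phi> \<Lambda> z F G =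
    (let v = coordinate_vector TA (tangent_dom U, tangent_coords U \<phi>) z;
         (x, w) = tangent_coords U \<phi> z
     in \<Sum>i\<in>Basis. \<Sum>j\<in>Basis.
       \<Lambda> i j x * (v (0, i) F * v (j, 0) G + v (i, 0) F * v (0, j) G) +
       frechet_derivative (\<Lambda> i j) (at x) w * (v (0, i) F * v (0, j) G))"

context
  fixes U \<phi> \<Lambda>
  assumes U: "(U, \<phi>) \<in> A"
    and smooth_\<Lambda>: "\<And>i j. i \<in> Basis \<Longrightarrow> j \<in> Basis \<Longrightarrow> smooth_on (\<Lambda> i j) (\<phi> ` U)"
    and \<Lambda>: "\<And>p f g. p \<in> U \<Longrightarrow> bracket f g p = (\<Sum>i\<in>Basis. \<Sum>j\<in>Basis. \<Lambda> i j (\<phi> p) *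
      (coordinate_vector A (U, \<phi>) p i f * coordinate_vector A (U, \<phi>) p j g))"
begin

text \<open>The product rule for the coordinate expression of the bracket. Its summands correspond
  to those of \<open>chart_lift\<close> on \<open>form f\<close> and \<open>form g\<close>:
  \<open>v i f\<close> is a fibre derivative of \<open>form f\<close>, and \<open>D f i w\<close> is
  a base derivative of it.\<close>

lemma bracket_derivative:
  assumes p: "p \<in> U" and f: "f \<in> sf" and g: "g \<in> sf"
  defines "v \<equiv> coordinate_vector A (U, \<phi>) p"
    and "D \<equiv> \<lambda>f i. frechet_derivative (\<lambda>x. frechet_derivative (f \<circ> inv_into U \<phi>) (at x) i) (at (\<phi> p))"
  shows "v w (bracket f g) = (\<Sum>i\<in>Basis. \<Sum>j\<in>Basis.
    \<Lambda> i j (\<phi> p) * (v i f * D g j w + D f i w * v j g) +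
    frechet_derivative (\<Lambda> i j) (at (\<phi> p)) w * (v i f * v j g))"
proof -
  let ?d = "\<lambda>f i x. frechet_derivative (f \<circ> inv_into U \<phi>) (at x) i"
  have pU: "\<phi> p \<in> \<phi> ` U" using p by simp
  have d: "(?d f i has_derivative D f i) (at (\<phi> p))" if "f \<in> sf" for f i
    unfolding D_def
    by (rule smooth_on_has_derivative[OF smooth_on_derivative[OF smooth_functions_chart[OF that U]] pU])
  have l: "(\<Lambda> i j has_derivative frechet_derivative (\<Lambda> i j) (at (\<phi> p))) (at (\<phi> p))"
    if "i \<in> Basis" "j \<in> Basis" for i j
    by (rule smooth_on_has_derivative[OF smooth_\<Lambda>[OF that] pU])
  have dv: "?d f i (\<phi> p) = v i f" if "f \<in> sf" for f i
    using that by (simp add: v_def coordinate_vector_def)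
  have "((\<lambda>x. \<Sum>i\<in>Basis. \<Sum>j\<in>Basis. \<Lambda> i j x * (?d f i x * ?d g j x)) has_derivative
      (\<lambda>w. \<Sum>i\<in>Basis. \<Sum>j\<in>Basis. \<Lambda> i j (\<phi> p) * (?d f i (\<phi> p) * D g j w + D f i w * ?d g j (\<phi> p)) +
        frechet_derivative (\<Lambda> i j) (at (\<phi> p)) w * (?d f i (\<phi> p) * ?d g j (\<phi> p)))) (at (\<phi> p))"
    by (intro has_derivative_sum has_derivative_mult l d f g)
  then have "(bracket f g \<circ> inv_into U \<phi> has_derivative
      (\<lambda>w. \<Sum>i\<in>Basis. \<Sum>j\<in>Basis. \<Lambda> i j (\<phi> p) * (?d f i (\<phi> p) * D g j w + D f i w * ?d g j (\<phi> p)) +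
        frechet_derivative (\<Lambda> i j) (at (\<phi> p)) w * (?d f i (\<phi> p) * ?d g j (\<phi> p)))) (at (\<phi> p))"
  proof (rule has_derivative_transform_within_open[OF _ open_chart_image[OF U] pU])
    fix x assume "x \<in> \<phi> ` U"
    then obtain q where q: "q \<in> U" "x = \<phi> q" by blast
    show "(\<Sum>i\<in>Basis. \<Sum>j\<in>Basis. \<Lambda> i j x * (?d f i x * ?d g j x)) = (bracket f g \<circ> inv_into U \<phi>) x"
      using \<Lambda>[OF q(1), of f g] f g inv_chart[OF U q(1)] by (simp add: q(2) coordinate_vector_def)
  qed
  from coordinate_vector_eqI[OF U p smooth_bracket[OF f g] this, of w]
  show ?thesis unfolding dv[OF f] dv[OF g] v_def .
qed

lemma tangent_lift_at_chart_lift: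
  assumes z: "z \<in> tangent_dom U"
  shows "tangent_lift_at z (chart_lift U \<phi> \<Lambda> z)"
proof -
  obtain p w where p: "p \<in> U" and z': "z = (p, coordinate_vector A (U, \<phi>) p w)"
    using tangent_dom_cases[OF U z] .
  let ?v = "coordinate_vector TA (tangent_dom U, tangent_coords U \<phi>) z"
  let ?u = "coordinate_vector A (U, \<phi>) p"
  let ?D = "\<lambda>f i. frechet_derivative (\<lambda>x. frechet_derivative (f \<circ> inv_into U \<phi>) (at x) i) (at (\<phi> p))"
  have lift: "chart_lift U \<phi> \<Lambda> z F G = (\<Sum>i\<in>Basis. \<Sum>j\<in>Basis.
       \<Lambda> i j (\<phi> p) * (?v (0, i) F * ?v (j, 0) G + ?v (i, 0) F * ?v (0, j) G) +
       frechet_derivative (\<Lambda> i j) (at (\<phi> p)) w * (?v (0, i) F * ?v (0, j) G))" for F G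
    unfolding chart_lift_def Let_def z' tangent_coords_coordinate_vector[OF U p] by simp
  have v: "?v a \<in> tangent_space TA z" for a
    by (rule T.coordinate_vector_tangent[OF tangent_atlasI[OF U] z])
  have t1: "(\<lambda>F. chart_lift U \<phi> \<Lambda> z F G) \<in> tangent_space TA z" for G
    unfolding lift
    by (intro T.tangent_space_sum T.tangent_space_add T.tangent_space_scale tangent_space_mult_left v)
  have t2: "(\<lambda>G. chart_lift U \<phi> \<Lambda> z F G) \<in> tangent_space TA z" for F
    unfolding lift by (intro T.tangent_space_sum T.tangent_space_add T.tangent_space_scale v)
  have u0: "?u 0 f = 0" for f
    using linear_0[OF bounded_linear.linear[OF bounded_linear_coordinate_vector[OF U p]]] .
  \<comment> \<open>For a vertical vector, \<open>lifted_vector_form\<close> contains a second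
    derivative with one direction 0, which has to be discarded.\<close>
  have D0: "?D f 0 w = 0" if f: "f \<in> sf" for f
  proof -
    have "frechet_derivative (f \<circ> inv_into U \<phi>) (at x) 0 = 0" if "x \<in> \<phi> ` U" for x
      using linear_0[OF has_derivative_linear[OF smooth_on_has_derivative[OF smooth_functions_chart[OF f U] that]]] .
    then have "?D f 0 = frechet_derivative (\<lambda>x. 0) (at (\<phi> p))"
      using open_chart_image[OF U] p by (intro frechet_derivative_cong[of "\<phi> ` U"]) auto
    then show ?thesis by (simp add: frechet_derivative_const)
  qed
  have pull: "?v (a, b) (pullback f) = ?u a f" if "f \<in> sf" for a b f
    unfolding z' by (rule lifted_vector_pullback[OF U p that])
  have frm: "?v (a, b) (form f) = ?D f a w + ?u b f" if "f \<in> sf" for a b f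
    unfolding z' by (rule lifted_vector_form[OF U p that])
  have zT: "z \<in> tangent_bundle A" using z by (simp add: tangent_dom_def)
  have pb: "pullback h z = h p" for h using zT by (simp add: tangent_pullback_def zero_ext_def z')
  have fm: "form h z = ?u w h" for h using zT by (simp add: form_function_def zero_ext_def z' differential_def)
  \<comment> \<open>Fibre derivatives kill pullbacks, and every term of the lift contains a fibre
    derivative. Hence two pullbacks give 0, and a mixed pair keeps only the \<Lambda> term whose
    base derivative falls on the pullback.\<close>
  have "chart_lift U \<phi> \<Lambda> z (form f) (form g) = form (bracket f g) z \<and>
      chart_lift U \<phi> \<Lambda> z (pullback f) (pullback g) = 0 \<and>
      chart_lift U \<phi> \<Lambda> z (form f) (pullback g) = pullback (bracket f g) z \<and>
      chart_lift U \<phi> \<Lambda> z (pullback f) (form g) = pullback (bracket f g) z"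
    if f: "f \<in> sf" and g: "g \<in> sf" for f g
    unfolding lift pb fm bracket_derivative[OF p f g] pull[OF f] pull[OF g] frm[OF f] frm[OF g]
      u0 D0[OF f] D0[OF g] \<Lambda>[OF p, of f g]
    by simp
  with t1 t2 show ?thesis unfolding tangent_lift_at_def by blast
qed

lemma chart_lift_smooth:
  assumes F: "F \<in> smooth_functions TA" and G: "G \<in> smooth_functions TA"
  shows "smooth_on ((\<lambda>z. chart_lift U \<phi> \<Lambda> z F G) \<circ> inv_into (tangent_dom U) (tangent_coords U \<phi>)) (\<phi> ` U \<times> UNIV)"
proof (rule smooth_on_cong)
  let ?inv = "inv_into (tangent_dom U) (tangent_coords U \<phi>)"
  let ?d = "\<lambda>F z a. frechet_derivative (F \<circ> ?inv) (at z) a"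
  show o: "open (\<phi> ` U \<times> (UNIV :: 'e set))" by (rule open_tangent_chart_image[OF U])
  have d: "smooth_on (\<lambda>z. ?d F z a) (\<phi> ` U \<times> UNIV)" if "F \<in> smooth_functions TA" for F a
    by (rule smooth_on_derivative[OF T.smooth_functions_chart[OF that tangent_atlasI[OF U],
        unfolded tangent_coords_image_dom[OF U]]])
  have l: "smooth_on (\<lambda>z. \<Lambda> i j (fst z)) (\<phi> ` U \<times> (UNIV :: 'e set))" if "i \<in> Basis" "j \<in> Basis" for i j
    by (rule smooth_on_compose[OF o open_chart_image[OF U] smooth_on_bounded_linear[OF bounded_linear_fst o] _
        smooth_\<Lambda>[OF that]]) auto
  show "smooth_on (\<lambda>z. \<Sum>i\<in>Basis. \<Sum>j\<in>Basis.
      \<Lambda> i j (fst z) * (?d F z (0, i) * ?d G z (j, 0) + ?d F z (i, 0) * ?d G z (0, j)) +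
      frechet_derivative (\<Lambda> i j) (at (fst z)) (snd z) * (?d F z (0, i) * ?d G z (0, j))) (\<phi> ` U \<times> UNIV)"
    by (intro smooth_on_sum smooth_on_add smooth_on_mult o l d F G
        smooth_on_differential open_chart_image[OF U] smooth_\<Lambda>)
  fix z assume "z \<in> \<phi> ` U \<times> (UNIV :: 'e set)"
  then obtain p w where p: "p \<in> U" "z = (\<phi> p, w)" by auto
  have inv: "?inv z = (p, coordinate_vector A (U, \<phi>) p w)"
    using inv_tangent_coords[OF U, of "\<phi> p" w] p by (simp add: inv_chart[OF U])
  have v: "coordinate_vector TA (tangent_dom U, tangent_coords U \<phi>) (p, coordinate_vector A (U, \<phi>) p w) a F = ?d F z a"
    if "F \<in> smooth_functions TA" for a F
    using that tangent_coords_coordinate_vector[OF U p(1), of w] by (simp add: coordinate_vector_def[of TA] p(2))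
  show "(\<Sum>i\<in>Basis. \<Sum>j\<in>Basis.
      \<Lambda> i j (fst z) * (?d F z (0, i) * ?d G z (j, 0) + ?d F z (i, 0) * ?d G z (0, j)) +
      frechet_derivative (\<Lambda> i j) (at (fst z)) (snd z) * (?d F z (0, i) * ?d G z (0, j))) =
      ((\<lambda>z. chart_lift U \<phi> \<Lambda> z F G) \<circ> ?inv) z"
    unfolding o_apply[of "\<lambda>z. chart_lift U \<phi> \<Lambda> z F G"] inv
    unfolding chart_lift_def Let_def tangent_coords_coordinate_vector[OF U p(1)] v[OF F] v[OF G]
    by (simp add: p(2))
qed

end

section \<open>The global lift\<close>

definition tangent_lift ::
    "('a \<times> 'a tangent_vector \<Rightarrow> real) \<Rightarrow> ('a \<times> 'a tangent_vector \<Rightarrow> real) \<Rightarrow> 'a \<times> 'a tangent_vector \<Rightarrow> real" where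
  "tangent_lift F G z = (if z \<in> tangent_bundle A then (THE b. tangent_lift_at z b) F G else 0)"

lemma tangent_lift_eqI:
  assumes "z \<in> tangent_bundle A" "tangent_lift_at z b"
  shows "tangent_lift F G z = b F G"
proof -
  have "(THE b. tangent_lift_at z b) = b"
    using assms tangent_lift_at_unique by blast
  then show ?thesis using assms by (simp add: tangent_lift_def)
qed

lemma tangent_lift_outside: "z \<notin> tangent_bundle A \<Longrightarrow> tangent_lift F G z = 0"
  by (simp add: tangent_lift_def)

lemma tangent_lift_at_tangent_lift:
  assumes z: "z \<in> tangent_bundle A"
  shows "tangent_lift_at z (\<lambda>F G. tangent_lift F G z)"
proof -
  have "fst z \<in> points A" using z by (auto simp: tangent_bundle_def)
  then obtain U \<phi> where U: "(U, \<phi>) \<in> A" "fst z \<in> U" by (rule point_in_chart)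
  have "z \<in> tangent_dom U" using z U by (simp add: tangent_dom_def)
  then obtain b where b: "tangent_lift_at z b"
    using bivector_exists[OF U(1)] tangent_lift_at_chart_lift[OF U(1)] by blast
  have "(\<lambda>F G. tangent_lift F G z) = b" using tangent_lift_eqI[OF z b] by (intro ext)
  then show ?thesis using b by simp
qed

text \<open>Pointwise uniqueness identifies the lift, over each chart domain, with the chart
  formula, which depends smoothly on the point.\<close>

lemma tangent_lift_smooth:
  assumes F: "F \<in> smooth_functions TA" and G: "G \<in> smooth_functions TA"
  shows "tangent_lift F G \<in> smooth_functions TA"
  unfolding smooth_functions_def
proof (intro CollectI conjI allI impI ballI)
  show "tangent_lift F G z = 0" if "z \<notin> points TA" for z
    using that by (simp add: points_tangent_atlas tangent_lift_def)
  fix c assume "c \<in> TA"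
  then obtain U \<phi> where U: "(U, \<phi>) \<in> A" "c = (tangent_dom U, tangent_coords U \<phi>)"
    using tangent_atlas_iff by (metis surj_pair)
  obtain \<Lambda> where \<Lambda>: "\<And>i j. i \<in> Basis \<Longrightarrow> j \<in> Basis \<Longrightarrow> smooth_on (\<Lambda> i j) (\<phi> ` U)"
    "\<And>p f g. p \<in> U \<Longrightarrow> bracket f g p = (\<Sum>i\<in>Basis. \<Sum>j\<in>Basis. \<Lambda> i j (\<phi> p) *
      (coordinate_vector A (U, \<phi>) p i f * coordinate_vector A (U, \<phi>) p j g))"
    using bivector_exists[OF U(1)] by blast
  have "smooth_on (tangent_lift F G \<circ> inv_into (tangent_dom U) (tangent_coords U \<phi>)) (\<phi> ` U \<times> UNIV)"
  proof (rule smooth_on_cong[OF open_tangent_chart_image[OF U(1)] _ chart_lift_smooth[OF U(1) \<Lambda> F G]])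
    fix x assume "x \<in> \<phi> ` U \<times> (UNIV :: 'e set)"
    then have z: "inv_into (tangent_dom U) (tangent_coords U \<phi>) x \<in> tangent_dom U"
      by (intro inv_into_into) (simp add: tangent_coords_image_dom[OF U(1)])
    then have "inv_into (tangent_dom U) (tangent_coords U \<phi>) x \<in> tangent_bundle A"
      by (simp add: tangent_dom_def)
    from tangent_lift_eqI[OF this tangent_lift_at_chart_lift[OF U(1) \<Lambda> z]]
    show "((\<lambda>z. chart_lift U \<phi> \<Lambda> z F G) \<circ> inv_into (tangent_dom U) (tangent_coords U \<phi>)) x =
        (tangent_lift F G \<circ> inv_into (tangent_dom U) (tangent_coords U \<phi>)) x" by simp
  qed
  then show "case c of (W, \<Phi>) \<Rightarrow> smooth_on (tangent_lift F G \<circ> inv_into W \<Phi>) (\<Phi> ` W)"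
    by (simp add: U(2) tangent_coords_image_dom[OF U(1)])
qed

lemma form_add: "f \<in> sf \<Longrightarrow> g \<in> sf \<Longrightarrow> form (f + g) = form f + form g"
  by (auto simp: form_function_def zero_ext_def differential_def fun_eq_iff tangent_bundle_def tangent_add)

lemma form_minus: "f \<in> sf \<Longrightarrow> form (- f) = - form f"
  by (auto simp: form_function_def zero_ext_def differential_def fun_eq_iff tangent_bundle_def tangent_minus)

lemma form_0: "form 0 = 0"
  by (auto simp: form_function_def zero_ext_def differential_def fun_eq_iff tangent_bundle_def tangent_0)

lemma pullback_add: "pullback (f + g) = pullback f + pullback g"
  by (auto simp: tangent_pullback_def zero_ext_def)

lemma pullback_minus: "pullback (- f) = - pullback f"
  by (auto simp: tangent_pullback_def zero_ext_def)

lemma pullback_0: "pullback 0 = 0"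
  by (auto simp: tangent_pullback_def zero_ext_def)

lemma tangent_lift_tangent:
  assumes "z \<in> tangent_bundle A"
  shows "(\<lambda>F. tangent_lift F G z) \<in> tangent_space TA z" "(\<lambda>G. tangent_lift F G z) \<in> tangent_space TA z"
  using tangent_lift_at_tangent_lift[OF assms] unfolding tangent_lift_at_def by auto

lemma tangent_lift_generators:
  assumes f: "f \<in> sf" and g: "g \<in> sf"
  shows "tangent_lift (form f) (form g) = form (bracket f g)"
    "tangent_lift (pullback f) (pullback g) = 0"
    "tangent_lift (form f) (pullback g) = pullback (bracket f g)"
    "tangent_lift (pullback f) (form g) = pullback (bracket f g)"
proof -
  have "tangent_lift (form f) (form g) z = form (bracket f g) z \<and> tangent_lift (pullback f) (pullback g) z = 0 \<and>
    tangent_lift (form f) (pullback g) z = pullback (bracket f g) z \<and>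
    tangent_lift (pullback f) (form g) z = pullback (bracket f g) z" for z
    using tangent_lift_at_tangent_lift[of z] f g
    by (cases "z \<in> tangent_bundle A")
      (auto simp: tangent_lift_at_def tangent_lift_outside form_function_def tangent_pullback_def zero_ext_def)
  then show "tangent_lift (form f) (form g) = form (bracket f g)"
    "tangent_lift (pullback f) (pullback g) = 0"
    "tangent_lift (form f) (pullback g) = pullback (bracket f g)"
    "tangent_lift (pullback f) (form g) = pullback (bracket f g)" by (auto simp: fun_eq_iff)
qed

text \<open>The negated lift with its arguments swapped meets the same pointwise description, the
  two mixed equations trading places, so uniqueness applies.\<close>

lemma tangent_lift_antisym: "tangent_lift F G = - tangent_lift G F"
proof
  fix z
  show "tangent_lift F G z = (- tangent_lift G F) z"
  proof (cases "z \<in> tangent_bundle A")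
    case True
    have "tangent_lift_at z (\<lambda>F G. (-1) * tangent_lift G F z)"
      unfolding tangent_lift_at_def
    proof (intro conjI allI ballI)
      fix f g assume f: "f \<in> sf" and g: "g \<in> sf"
      note anti = antisym_bracket[OF f g]
      note gens = tangent_lift_generators[OF g f]
      show "(-1) * tangent_lift (form g) (form f) z = form (bracket f g) z"
        unfolding gens anti form_minus[OF smooth_bracket[OF g f]] by simp
      show "(-1) * tangent_lift (pullback g) (pullback f) z = 0" unfolding gens by simp
      show "(-1) * tangent_lift (pullback g) (form f) z = pullback (bracket f g) z"
        unfolding gens anti pullback_minus by simp
      show "(-1) * tangent_lift (form g) (pullback f) z = pullback (bracket f g) z"
        unfolding gens anti pullback_minus by simp
    qed (intro T.tangent_space_scale tangent_lift_tangent True)+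
    from tangent_lift_eqI[OF True this, of F G] show ?thesis by simp
  qed (simp add: tangent_lift_outside)
qed

text \<open>Except for smoothness and antisymmetry, each axiom says at a point of the bundle that a
  slot of the lift is a tangent vector.\<close>

lemma almost_poisson_tangent_lift: "almost_poisson_manifold TA tangent_lift"
proof unfold_locales
  fix F G H :: "'a \<times> 'a tangent_vector \<Rightarrow> real" and c :: real
  show "tangent_lift F G = 0" if undef: "F \<notin> smooth_functions TA \<or> G \<notin> smooth_functions TA"
  proof
    show "tangent_lift F G z = 0 z" for z
      using undef T.tangent_undefined[OF tangent_lift_tangent(1), of z F G]
        T.tangent_undefined[OF tangent_lift_tangent(2), of z G F]
      by (cases "z \<in> tangent_bundle A") (auto simp: tangent_lift_outside)
  qed
  assume F: "F \<in> smooth_functions TA" and G: "G \<in> smooth_functions TA"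
  show "tangent_lift F G \<in> smooth_functions TA" by (rule tangent_lift_smooth[OF F G])
  show "tangent_lift (\<lambda>z. c * F z) G = (\<lambda>z. c * tangent_lift F G z)"
  proof
    show "tangent_lift (\<lambda>z. c * F z) G z = c * tangent_lift F G z" for z
      using T.tangent_scale[OF tangent_lift_tangent(1) F, of z c G]
      by (cases "z \<in> tangent_bundle A") (auto simp: tangent_lift_outside)
  qed
  show "tangent_lift F G = - tangent_lift G F" by (rule tangent_lift_antisym)
  assume H: "H \<in> smooth_functions TA"
  show "tangent_lift (F + G) H = tangent_lift F H + tangent_lift G H"
  proof
    show "tangent_lift (F + G) H z = (tangent_lift F H + tangent_lift G H) z" for z
      using T.tangent_add[OF tangent_lift_tangent(1) F G, of z H]
      by (cases "z \<in> tangent_bundle A") (auto simp: tangent_lift_outside)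
  qed
  show "tangent_lift F (G * H) = tangent_lift F G * H + G * tangent_lift F H"
  proof
    show "tangent_lift F (G * H) z = (tangent_lift F G * H + G * tangent_lift F H) z" for z
      using T.tangent_mult[OF tangent_lift_tangent(2) G H, of z F]
      by (cases "z \<in> tangent_bundle A") (auto simp: tangent_lift_outside)
  qed
qed

interpretation L: almost_poisson_manifold "tangent_atlas A" tangent_lift
  by (rule almost_poisson_tangent_lift)

section \<open>The Jacobi identity and the uniqueness of the lift\<close>

text \<open>Separation acts on the first argument of the Jacobiator, and cyclic symmetry rotates the
  others into that place. So the arguments pass from generators to arbitrary smooth functions one at
  a time, in three rounds.\<close>

lemma tangent_lift_Jacobi:
  assumes F: "F \<in> smooth_functions TA" and G: "G \<in> smooth_functions TA" and H: "H \<in> smooth_functions TA"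
  shows "L.jacobiator F G H = 0"
proof -
  define gens where "gens = form ` sf \<union> pullback ` sf"
  have outside: "L.jacobiator F G H z = 0" if "z \<notin> tangent_bundle A" for F G H z
    using that by (simp add: L.jacobiator_def tangent_lift_outside)
  have separate: "L.jacobiator F G H = 0"
    if G: "G \<in> smooth_functions TA" and H: "H \<in> smooth_functions TA"
      and gen: "\<And>X. X \<in> gens \<Longrightarrow> L.jacobiator X G H = 0" for F G H
  proof
    fix z
    show "L.jacobiator F G H z = 0 z"
    proof (cases "z \<in> tangent_bundle A")
      case True
      show ?thesis
        using fun_cong[OF tangent_lift_separation[OF L.jacobiator_tangent[OF G H] True], of F] gen
        by (simp add: gens_def)
    qed (simp add: outside)
  qed
  note generators = tangent_lift_generators smooth_bracket L.zero_bracket_right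
  have zero: "form (bracket f (bracket g h)) + form (bracket g (bracket h f)) + form (bracket h (bracket f g)) = 0"
    "pullback (bracket f (bracket g h)) + pullback (bracket g (bracket h f)) + pullback (bracket h (bracket f g)) = 0"
    if "f \<in> sf" "g \<in> sf" "h \<in> sf" for f g h
  proof -
    show "form (bracket f (bracket g h)) + form (bracket g (bracket h f)) + form (bracket h (bracket f g)) = 0"
      using bracket_Jacobi[OF that] that
      by (simp add: form_add[symmetric] smooth_functions_add smooth_bracket form_0)
    show "pullback (bracket f (bracket g h)) + pullback (bracket g (bracket h f)) + pullback (bracket h (bracket f g)) = 0"
      using bracket_Jacobi[OF that] by (simp add: pullback_add[symmetric] pullback_0)
  qed
  \<comment> \<open>With two or three pullbacks every term vanishes. With exactly one the sum is the
    pullback of the Jacobi identity on P, and with none it is the differential of that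
    identity.\<close>
  have ggg: "L.jacobiator X Y Z = 0" if "X \<in> gens" "Y \<in> gens" "Z \<in> gens" for X Y Z
    using that unfolding gens_def by (auto simp: L.jacobiator_def generators zero)
  have smooth_gen: "X \<in> smooth_functions TA" if "X \<in> gens" for X
    using that form_function_smooth tangent_pullback_smooth unfolding gens_def by blast
  have Fgg: "L.jacobiator F Y Z = 0" if "Y \<in> gens" "Z \<in> gens" for F Y Z
    by (rule separate[OF smooth_gen[OF that(1)] smooth_gen[OF that(2)] ggg[OF _ that]])
  \<comment> \<open>After rotation the arbitrary \<open>G\<close> stands in the first place and the
    generators \<open>Z\<close> and \<open>X\<close> follow, which is the case already
    settled.\<close>
  have FGg: "L.jacobiator F G Z = 0" if G: "G \<in> smooth_functions TA" and Z: "Z \<in> gens" for F G Z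
  proof (rule separate[OF G smooth_gen[OF Z]])
    show "L.jacobiator X G Z = 0" if "X \<in> gens" for X
      unfolding L.jacobiator_cyclic[of X] by (rule Fgg[OF Z that])
  qed
  show ?thesis
  proof (rule separate[OF G H])
    show "L.jacobiator X G H = 0" if "X \<in> gens" for X
      unfolding L.jacobiator_cyclic[of X] by (rule FGg[OF H that])
  qed
qed

lemma poisson_tangent_lift: "poisson_manifold TA tangent_lift"
  by (rule L.poisson_manifoldI) (rule tangent_lift_Jacobi)

text \<open>Antisymmetry of \<open>b\<close> supplies the mixed equation in the other order, after
  which pointwise uniqueness applies on the bundle. Off the bundle \<open>b\<close> is 0, either as
  a smooth function there or by the convention for non-smooth arguments.\<close>

lemma tangent_lift_unique:
  assumes "poisson_manifold TA b"
    and gen: "\<And>f g. f \<in> sf \<Longrightarrow> g \<in> sf \<Longrightarrow> b (form f) (form g) = form (bracket f g)"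
      "\<And>f g. f \<in> sf \<Longrightarrow> g \<in> sf \<Longrightarrow> b (pullback f) (pullback g) = 0"
      "\<And>f g. f \<in> sf \<Longrightarrow> g \<in> sf \<Longrightarrow> b (form f) (pullback g) = pullback (bracket f g)"
  shows "b = tangent_lift"
proof (intro ext)
  interpret B: poisson_manifold TA b by fact
  fix F G z
  show "b F G z = tangent_lift F G z"
  proof (cases "z \<in> tangent_bundle A")
    case True
    have "b (pullback f) (form g) = pullback (bracket f g)" if f: "f \<in> sf" and g: "g \<in> sf" for f g
      using B.antisym_bracket[OF tangent_pullback_smooth[OF f] form_function_smooth[OF g]]
      unfolding gen(3)[OF g f] antisym_bracket[OF g f] pullback_minus by simp
    then have "tangent_lift_at z (\<lambda>F G. b F G z)"
      unfolding tangent_lift_at_def using gen by (simp add: B.bracket_tangent B.bracket_tangent_right)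
    from tangent_lift_eqI[OF True this] show ?thesis by simp
  next
    case False
    have "b F G z = 0"
    proof (cases "F \<in> smooth_functions TA \<and> G \<in> smooth_functions TA")
      case True
      then show ?thesis
        using T.smooth_functions_zero[OF B.smooth_bracket] False by (simp add: points_tangent_atlas)
    next
      case False
      then show ?thesis using B.undefined_bracket[of F G] by auto
    qed
    then show ?thesis using False by (simp add: tangent_lift_outside)
  qed
qed

end

theorem theorem6p4p1:
  fixes P :: "('a, 'e::euclidean_space) chart set"
    and bracketP :: "('a \<Rightarrow> real) \<Rightarrow> ('a \<Rightarrow> real) \<Rightarrow> 'a \<Rightarrow> real"
  assumes "poisson_manifold P bracketP"
  shows "\<exists>!bracketTP.
           poisson_manifold (tangent_atlas P) bracketTP \<and>
           (\<forall>f \<in> smooth_functions P. \<forall>g \<in> smooth_functions P.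
              bracketTP (form_function P (differential f)) (form_function P (differential g)) =
                form_function P (differential (bracketP f g)) \<and>
              bracketTP (tangent_pullback P f) (tangent_pullback P g) = 0 \<and>
              bracketTP (form_function P (differential f)) (tangent_pullback P g) =
                tangent_pullback P (bracketP f g))"
proof -
  interpret poisson_manifold P bracketP by fact
  show ?thesis
  proof (rule ex1I[of _ tangent_lift], intro conjI ballI)
    show "poisson_manifold (tangent_atlas P) tangent_lift" by (rule poisson_tangent_lift)
  qed (auto simp: tangent_lift_generators intro!: tangent_lift_unique)
qed

end
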